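(* Let $\lambda,\mu,\delta$ be real numbers with $0<\lambda<1$, $\mu>0$ and $1-\lambda<\delta<d_{\lambda,\mu}$. Set $f=f_{\lambda,\mu,\delta}$, let $\rho=\rho_{\lambda,\mu,\delta}$ be its rotation number, $\phi=\phi_{\lambda,\mu,\delta,\rho}$, and $C=\bigcap_{k\ge1}f^k(I)$. For $x\in I$ let $\omega(x)=\bigcap_{n\ge0}\overline{\bigcup_{k\ge n}\{f^k(x)\}}$ be its $\omega$-limit set (closures taken in $\mathbb R$, and $\{f^k(x)\}$ here denoting a singleton). (i) Assume that $\rho$ is irrational. Then $C=\phi(I)$ and the restriction of $f$ to the invariant set $C$ is conjugate by $\phi$ to the rotation $R_\rho:I\to I$, $y\mapsto y+\rho \bmod 1$; in other words $f(\phi(y))=\phi(R_\rho(y))$ for all $y\in I$, where $\phi$ maps $I$ onto $C$. Moreover $\overline{\phi(I)}$ is a Cantor set and, for every $x\in I$, $\omega(x)=\overline C$. (ii) Assume that $\rho=p/q$ is rational, where $p$ and $q$ are relatively prime, and that $$\delta\left(\lambda,\mu,(p/q)^-\right)\le\delta<\delta\left(\lambda,\mu,p/q\right).$$ Then $C=\phi(I)=\{\phi(m/q):0\le m\le q-1\}$ is a cycle of $f$ of order $q$, and $f(\phi(y))=\phi(R_{p/q}(y))$ for every $y\in\{m/q:0\le m\le q-1\}$, where $R_{p/q}$ is the rotation $y\mapsto y+p/q\bmod1$. Moreover, for every $x\in I$, $\omega(x)=C$. (iii) Assume that $\delta=\delta(\lambda,\mu,p/q)$ for a rational number $p/q$ with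 $0<p/q<r_{\lambda,\mu}$, where $p$ and $q$ are relatively prime positive integers. Then the limit set $C$ is empty and $\phi(I)$ is a finite set with $q$ elements containing $1$. For every $x\in I$, $\omega(x)=\phi(I)$.
   Context: Let $I=[0,1)$; $\lfloor x\rfloor$ is the floor and $\{x\}=x-\lfloor x\rfloor$ the fractional part of a real $x$. For real numbers $0<\lambda<1$, $\mu>0$ put $$d_{\lambda,\mu}=\begin{cases}1&\text{if }\lambda\mu<1,\\ \frac{\mu-\lambda\mu}{\mu-1}&\text{if }\lambda\mu\ge1,\end{cases}\qquad r_{\lambda,\mu}=\begin{cases}1&\text{if }\lambda\mu<1,\\ \frac{-\log\lambda}{\log\mu}&\text{if }\lambda\mu\ge1.\end{cases}$$ Map and rotation number. For $1-\lambda<\delta<d_{\lambda,\mu}$ put $\eta=\frac{1-\delta}{\lambda}$ and let $f=f_{\lambda,\mu,\delta}:I\to I$ be defined by $f(x)=\lambda x+\delta$ if $0\le x<\eta$, and $f(x)=\mu(\lambda x+\delta-1)$ if $\eta\le x<1$. Its lift $F=F_{\lambda,\mu,\delta}:\mathbb R\to\mathbb R$ is $$F(x)=\begin{cases}\lambda x+\delta+(1-\lambda)\lfloor x\rfloor&\text{if }0\le\{x\}<\eta,\\ \mu(\lambda x+\delta-1)+1+(1-\lambda\mu)\lfloor x\rfloor&\text{if }\eta\le\{x\}<1.\end{cases}$$ $F$ is increasing, $F(x+1)=F(x)+1$ and $\{F(x)\}=f(\{x\})$. The rotation number of $f$ is $\rho_{\lambda,\mu,\delta}=\lim_{k\to\infty}F^k(x)/k$,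 which exists and does not depend on $x\in\mathbb R$ (a known fact); it lies in $(0,r_{\lambda,\mu})$. The function $\delta(\lambda,\mu,\rho)$. For $0<\rho<r_{\lambda,\mu}$ (so that $\lambda\mu^\rho<1$), set $$\sigma(\lambda,\mu,\rho)=\sum_{k\ge1}\left(\lfloor(k+1)\rho\rfloor-\lfloor k\rho\rfloor\right)\lambda^k\mu^{\lfloor k\rho\rfloor},\qquad \delta(\lambda,\mu,\rho)=\frac{(1-\lambda)(1+\mu\,\sigma(\lambda,\mu,\rho))}{1+(\mu-1)\sigma(\lambda,\mu,\rho)}.$$ $\delta(\lambda,\mu,\rho_0^-)=\lim_{\rho\nearrow\rho_0}\delta(\lambda,\mu,\rho)$ denotes the left limit in $\rho$. The function $\phi$. For positive $\lambda,\mu,\rho$ with $\lambda\mu^\rho<1$ and real $\delta$, $\phi_{\lambda,\mu,\delta,\rho}:\mathbb R\to\mathbb R$ is defined by the convergent series $$\phi_{\lambda,\mu,\delta,\rho}(y)=\lfloor y\rfloor+\frac{1-\delta}{\lambda}+\sum_{k\ge0}\lambda^k\mu^{\lfloor y\rfloor-\lfloor y-k\rho\rfloor}\left(\frac{\lambda+\delta-1}{\lambda}+\lfloor y-(k+1)\rho\rfloor-\lfloor y-k\rho\rfloor\right).$$ A Cantor set is a topological space homeomorphic to the standard middle-thirds Cantor set. *)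

theory Defs
  imports "HOL-Analysis.Analysis"
begin

abbreviation I01 :: "real set" where
  "I01 \<equiv> {0..<1}"

definition d_bound :: "real \<Rightarrow> real \<Rightarrow> real" where
  "d_bound lam \<mu> = (if lam * \<mu> < 1 then 1 else (\<mu> - lam * \<mu>) / (\<mu> - 1))"

definition r_bound :: "real \<Rightarrow> real \<Rightarrow> real" where
  "r_bound lam \<mu> = (if lam * \<mu> < 1 then 1 else - ln lam / ln \<mu>)"

text \<open>This is meant as a self-map of \<open>[0,1)\<close>; its values outside
  that interval are irrelevant.\<close>

definition circ_map :: "real \<Rightarrow> real \<Rightarrow> real \<Rightarrow> real \<Rightarrow> real" where
  "circ_map lam \<mu> \<delta> x =
     (if x < (1 - \<delta>) / lam then lam * x + \<delta> else \<mu> * (lam * x + \<delta> - 1))"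

definition circ_lift :: "real \<Rightarrow> real \<Rightarrow> real \<Rightarrow> real \<Rightarrow> real" where
  "circ_lift lam \<mu> \<delta> x =
     (if frac x < (1 - \<delta>) / lam
      then lam * x + \<delta> + (1 - lam) * of_int \<lfloor>x\<rfloor>
      else \<mu> * (lam * x + \<delta> - 1) + 1 + (1 - lam * \<mu>) * of_int \<lfloor>x\<rfloor>)"

definition rotation_number :: "real \<Rightarrow> real \<Rightarrow> real \<Rightarrow> real" where
  "rotation_number lam \<mu> \<delta> =
     (THE \<rho>. \<forall>x. (\<lambda>k. (circ_lift lam \<mu> \<delta> ^^ k) x / real k) \<longlonglongrightarrow> \<rho>)"

text \<open>The sum over \<open>k \<ge> 1\<close> is indexed by \<open>k = Suc n\<close>.\<close>

definition sigma_fun :: "real \<Rightarrow> real \<Rightarrow> real \<Rightarrow> real" where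
  "sigma_fun lam \<mu> \<rho> =
     (\<Sum>n. of_int (\<lfloor>real (Suc n + 1) * \<rho>\<rfloor> - \<lfloor>real (Suc n) * \<rho>\<rfloor>)
           * lam ^ Suc n * \<mu> powi \<lfloor>real (Suc n) * \<rho>\<rfloor>)"

definition delta_fun :: "real \<Rightarrow> real \<Rightarrow> real \<Rightarrow> real" where
  "delta_fun lam \<mu> \<rho> =
     (1 - lam) * (1 + \<mu> * sigma_fun lam \<mu> \<rho>) / (1 + (\<mu> - 1) * sigma_fun lam \<mu> \<rho>)"

definition delta_left :: "real \<Rightarrow> real \<Rightarrow> real \<Rightarrow> real" where
  "delta_left lam \<mu> \<rho> = Lim (at_left \<rho>) (delta_fun lam \<mu>)"

definition phi_fun :: "real \<Rightarrow> real \<Rightarrow> real \<Rightarrow> real \<Rightarrow> real \<Rightarrow> real" where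
  "phi_fun lam \<mu> \<delta> \<rho> y =
     of_int \<lfloor>y\<rfloor> + (1 - \<delta>) / lam
     + (\<Sum>k. lam ^ k * \<mu> powi (\<lfloor>y\<rfloor> - \<lfloor>y - real k * \<rho>\<rfloor>)
             * ((lam + \<delta> - 1) / lam
                + of_int (\<lfloor>y - real (k + 1) * \<rho>\<rfloor> - \<lfloor>y - real k * \<rho>\<rfloor>)))"

definition rot :: "real \<Rightarrow> real \<Rightarrow> real" where
  "rot \<rho> y = frac (y + \<rho>)"

definition omega_limit :: "(real \<Rightarrow> real) \<Rightarrow> real \<Rightarrow> real set" where
  "omega_limit f x = (\<Inter>n. closure (\<Union>k\<in>{n..}. {(f ^^ k) x}))"

definition is_cycle :: "('a \<Rightarrow> 'a) \<Rightarrow> nat \<Rightarrow> 'a set \<Rightarrow> bool" where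
  "is_cycle f q S \<longleftrightarrow>
     q > 0 \<and> (\<exists>x. (f ^^ q) x = x \<and> inj_on (\<lambda>k. (f ^^ k) x) {..<q} \<and> S = (\<lambda>k. (f ^^ k) x) ` {..<q})"

primrec middle_thirds_stage :: "nat \<Rightarrow> real set" where
  "middle_thirds_stage 0 = {0..1}"
| "middle_thirds_stage (Suc n) =
     (\<lambda>x. x / 3) ` middle_thirds_stage n \<union> (\<lambda>x. (x + 2) / 3) ` middle_thirds_stage n"

definition middle_thirds_cantor :: "real set" where
  "middle_thirds_cantor = (\<Inter>n. middle_thirds_stage n)"

definition cantor_set :: "real set \<Rightarrow> bool" where
  "cantor_set S \<longleftrightarrow> S homeomorphic middle_thirds_cantor"

end

(*
  Along an orbit x_k of the lift F the integer parts m_k determine the affine branch used, so two orbits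
  with the same integer parts approach each other geometrically, because lam * mu^rho < 1. The integer
  parts of every forward or backward orbit deviate from k * rho by at most 1, which forces
  m_k = floor (y + k * rho) for some y and all large k. Since phi (y + k * rho) obeys the same
  recursion, every forward orbit is asymptotic to phi (y + k * rho), and every backward orbit
  eventually coincides with such a sequence. Recurrence of y + k * rho (with right continuity
  of phi) then gives floor y <= phi y <= floor y + 1 and identifies all omega-limit sets with the closure
  of phi(I). If phi y < floor y + 1 for all y, then phi conjugates the rotation to F and C = phi(I). This holds for
  irrational rho, as phi is then strictly increasing; its jumps on a dense set make closure (phi(I)) a
  Cantor set. For rho = p/q the sign of phi (-1/q) is that of delta - delta(lam, mu, p/q): if negative,
  phi(I) is a q-cycle. If it is zero, an explicit recursion for the increments of phi shows that the
  rotation number is p/q, and phi takes the integer value 0 at the negative point -1/q, which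
  no backward orbit of F can do, so that C is empty.
*)

theory Submission
  imports Defs
begin

section \<open>The lift and its rotation number\<close>

text \<open>The obstacle is that \<open>phi\<close> is a series whose range and monotonicity are not
  visible, while \<open>F\<close> jumps at every integer:
  \<open>F (phi y) = phi (y + \<rho>)\<close> can only be expected once \<open>phi y\<close> is
  known to have the integer part of \<open>y\<close>. So the comparison of orbits is carried out
  with the affine recursion alone, which needs the sequence of integer parts but not the position of
  the values. The value \<open>of_int \<lfloor>y\<rfloor> + 1\<close> cannot be excluded in advance;
  it means that the discontinuity is met from the left. For this reason \<open>T\<close> is used at
  1 too, and the closed range of \<open>phi\<close> is studied before the strict one. Turning the
  bound on the integer parts into an exact floor formula requires excluding deviations exactly 1
  apart. Irrationality allows this at no more than one index; for p/q the order of x + p and the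
  q-th iterate of x persists along the orbit and makes the integer parts eventually periodic up to
  drift.\<close>

locale contracted_map =
  fixes lam \<mu> \<delta> :: real
  assumes lam_pos: "0 < lam" and lam_less_1: "lam < 1" and mu_pos: "0 < \<mu>"
    and delta_gt: "1 - lam < \<delta>" and delta_less_1: "\<delta> < 1"
    and jump_pos: "\<mu> * (lam + \<delta> - 1) < \<delta>"
begin

definition \<eta> :: real where "\<eta> = (1 - \<delta>) / lam"

text \<open>The summand 1 makes the two affine pieces meet at (\<open>\<eta>\<close>, 1), so
  \<open>T\<close> is continuous. \<open>T 1\<close> lies outside the range of \<open>frac\<close>
  and is the left limit of \<open>F\<close> at 1.\<close>

definition T :: "real \<Rightarrow> real" where
  "T x = (if x < \<eta> then lam * x + \<delta> else \<mu> * (lam * x + \<delta> - 1) + 1)"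

definition F :: "real \<Rightarrow> real" where
  "F x = of_int \<lfloor>x\<rfloor> + T (frac x)"

definition \<kappa> :: real where "\<kappa> = lam * min 1 \<mu>"

lemma eta_pos: "0 < \<eta>" and eta_less_1: "\<eta> < 1"
  using lam_pos delta_gt delta_less_1 by (auto simp: \<eta>_def field_simps)

lemma lam_eta: "lam * \<eta> = 1 - \<delta>"
  using lam_pos by (simp add: \<eta>_def)

lemma kappa_pos: "0 < \<kappa>" and kappa_less_1: "\<kappa> < 1"
  and kappa_le_lam: "\<kappa> \<le> lam" and kappa_le_lam_mu: "\<kappa> \<le> lam * \<mu>"
proof -
  show "0 < \<kappa>" using lam_pos mu_pos by (simp add: \<kappa>_def)
  show "\<kappa> \<le> lam" using mult_left_mono[of "min 1 \<mu>" 1 lam] lam_pos by (simp add: \<kappa>_def)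
  then show "\<kappa> < 1" using lam_less_1 by simp
  show "\<kappa> \<le> lam * \<mu>" using lam_pos by (simp add: \<kappa>_def)
qed

lemma T_low: "x \<le> \<eta> \<Longrightarrow> T x = 1 + lam * (x - \<eta>)"
  using lam_eta by (cases "x = \<eta>") (auto simp: T_def algebra_simps)

lemma T_high: assumes "\<eta> \<le> x" shows "T x = 1 + lam * \<mu> * (x - \<eta>)"
proof -
  have "\<mu> * (lam * x + \<delta> - 1) = \<mu> * (lam * x - lam * \<eta>)" using lam_eta by simp
  then show ?thesis using assms by (simp add: T_def algebra_simps)
qed

lemma T_0: "T 0 = \<delta>" using eta_pos by (simp add: T_def)

lemma T_1: "T 1 = \<mu> * (lam + \<delta> - 1) + 1" using eta_less_1 by (simp add: T_def)

lemma T_1_less: "T 1 < 1 + T 0" using jump_pos by (simp add: T_0 T_1)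

lemma T_lower_lipschitz: assumes "u \<le> v" shows "\<kappa> * (v - u) \<le> T v - T u"
proof -
  have low: "\<kappa> * (y - x) \<le> lam * (y - x)" and high: "\<kappa> * (y - x) \<le> lam * \<mu> * (y - x)"
    if "x \<le> y" for x y
    using that kappa_le_lam kappa_le_lam_mu by (simp_all add: mult_right_mono)
  consider "v \<le> \<eta>" | "\<eta> \<le> u" | "u \<le> \<eta>" "\<eta> \<le> v" by linarith
  then show ?thesis
  proof cases
    case 1 then show ?thesis using low[of u v] assms by (simp add: T_low algebra_simps)
  next
    case 2 then show ?thesis using high[of u v] assms by (simp add: T_high algebra_simps)
  next
    case 3 then show ?thesis using low[of u \<eta>] high[of \<eta> v] by (simp add: T_low T_high algebra_simps)
  qed
qed

lemma T_mono: "u \<le> v \<Longrightarrow> T u \<le> T v"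
  using T_lower_lipschitz[of u v] mult_nonneg_nonneg[OF less_imp_le[OF kappa_pos], of "v - u"] by linarith

text \<open>The segment is cut at the integers: every part grows at rate at least
  \<open>\<kappa>\<close>, and the upward jump \<open>1 + T 0 - T 1\<close> is discarded. The closed
  range of \<open>u\<close> and \<open>v\<close> admits the pair \<open>m\<close>, 1, which stands
  for \<open>m + 1\<close> reached from the left.\<close>

lemma lift_lower_lipschitz:
  fixes m n :: int and u v :: real
  assumes "m \<le> n" "0 \<le> u" "u \<le> 1" "0 \<le> v" "v \<le> 1" "m + u \<le> n + v"
  shows "\<kappa> * ((n + v) - (m + u)) \<le> (n + T v) - (m + T u)"
proof (cases "m = n")
  case True
  then show ?thesis using T_lower_lipschitz[of u v] assms by simp
next
  case False
  then have d: "real_of_int n - m - 1 \<ge> 0" using assms(1) by linarith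
  have "\<kappa> * (1 - u) \<le> T 1 - T u" "\<kappa> * v \<le> T v - T 0"
    using T_lower_lipschitz[of u 1] T_lower_lipschitz[of 0 v] assms by auto
  moreover have "\<kappa> * (n - m - 1) \<le> real_of_int n - m - 1"
    using mult_right_mono[OF less_imp_le[OF kappa_less_1] d] by simp
  ultimately show ?thesis using T_1_less by (simp add: algebra_simps)
qed

lemma F_strict_mono: assumes "x < y" shows "F x < F y"
proof -
  have "\<kappa> * (y - x) \<le> F y - F x"
    using lift_lower_lipschitz[of "\<lfloor>x\<rfloor>" "\<lfloor>y\<rfloor>" "frac x" "frac y"] assms
    by (simp add: F_def floor_mono frac_lt_1 less_imp_le) (simp add: frac_def)
  then show ?thesis using mult_pos_pos[OF kappa_pos, of "y - x"] assms by simp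
qed

lemma F_add_int: "F (x + of_int n) = F x + of_int n"
  by (simp add: F_def frac_def)

lemma F_iter_mono: "x \<le> y \<Longrightarrow> (F ^^ k) x \<le> (F ^^ k) y"
  by (induction k) (auto simp: le_less F_strict_mono)

lemma F_iter_strict_mono: "x < y \<Longrightarrow> (F ^^ k) x < (F ^^ k) y"
  by (induction k) (auto simp: F_strict_mono)

lemma F_iter_add_int: "(F ^^ k) (x + of_int n) = (F ^^ k) x + of_int n"
  by (induction k) (auto simp: F_add_int)

lemma inj_F: "inj F"
  by (metis F_strict_mono injI linorder_neqE less_irrefl)

lemma floor_F: "\<lfloor>F x\<rfloor> = \<lfloor>x\<rfloor> + (if frac x < \<eta> then 0 else 1)"
proof -
  have r: "0 \<le> frac x" "frac x < 1" by (auto simp: frac_lt_1)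
  have "\<lfloor>T (frac x)\<rfloor> = (if frac x < \<eta> then 0 else 1)"
  proof (cases "frac x < \<eta>")
    case True
    have "T (frac x) < 1" using True lam_pos by (simp add: T_low mult_less_0_iff)
    moreover have "0 \<le> T (frac x)" using T_mono[OF r(1)] T_0 delta_gt lam_less_1 by simp
    ultimately show ?thesis using True by (simp add: floor_eq_iff)
  next
    case False
    have "T (frac x) < 2" using T_mono[OF less_imp_le[OF r(2)]] T_1_less T_0 delta_less_1 by simp
    moreover have "1 \<le> T (frac x)" using False lam_pos mu_pos by (simp add: T_high)
    ultimately show ?thesis using False by (simp add: floor_eq_iff)
  qed
  then show ?thesis by (simp add: F_def)
qed

text \<open>By \<open>floor_F\<close> the integer part grows by 0 or 1 according to the branch, so a
  power of \<open>\<mu>\<close> replaces the case distinction; \<open>phi_shift\<close> has the same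
  shape.\<close>

lemma F_eq:
  "F x = of_int \<lfloor>x\<rfloor> + 1 + lam * \<mu> powi (\<lfloor>F x\<rfloor> - \<lfloor>x\<rfloor>) * (x - of_int \<lfloor>x\<rfloor> - \<eta>)"
  by (cases "frac x < \<eta>") (simp_all add: floor_F, simp_all add: F_def T_low T_high frac_def)

text \<open>\<open>T u - u\<close> is affine on both sides of \<open>\<eta>\<close>, so its extremes
  are among the values \<open>\<delta>\<close>, \<open>1 - \<eta>\<close> and
  \<open>\<mu> * (lam + \<delta> - 1)\<close> at 0, \<open>\<eta>\<close> and 1. The last is absent
  from \<open>b\<close> because \<open>jump_pos\<close> puts it below
  \<open>\<delta>\<close>.\<close>

lemma displacement_bounds: "\<exists>a b. 0 < a \<and> b < 1 \<and> (\<forall>x. x + a \<le> F x \<and> F x \<le> x + b)"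
proof -
  define a where "a = Min {\<delta>, 1 - \<eta>, \<mu> * (lam + \<delta> - 1)}"
  define b where "b = Max {\<delta>, 1 - \<eta>}"
  have "x + a \<le> F x \<and> F x \<le> x + b" for x
  proof -
    define u where "u = frac x"
    have u: "0 \<le> u" "u < 1" by (auto simp: u_def frac_lt_1)
    have "u + a \<le> T u \<and> T u \<le> u + b"
    proof (cases "u \<le> \<eta>")
      case True
      have eq: "T u - u = (1 - \<eta>) + (1 - lam) * (\<eta> - u)" using True by (simp add: T_low algebra_simps)
      moreover have "(1 - lam) * (\<eta> - u) \<le> (1 - lam) * \<eta>" using lam_less_1 u by (simp add: mult_left_mono)
      moreover have "0 \<le> (1 - lam) * (\<eta> - u)" using True lam_less_1 by simp
      moreover have "(1 - \<eta>) + (1 - lam) * \<eta> = \<delta>" using lam_eta by (simp add: algebra_simps)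
      moreover have "a \<le> 1 - \<eta>" "\<delta> \<le> b" by (auto simp: a_def b_def)
      ultimately show ?thesis by linarith
    next
      case False
      have eq: "T u - u = 1 - \<eta> + (lam * \<mu> - 1) * (u - \<eta>)" using False by (simp add: T_high algebra_simps)
      have one: "1 - \<eta> + (lam * \<mu> - 1) * (1 - \<eta>) = \<mu> * (lam + \<delta> - 1)"
        using T_high[of 1] T_1 eta_less_1 by (simp add: algebra_simps)
      have "a \<le> 1 - \<eta>" "a \<le> \<mu> * (lam + \<delta> - 1)" "\<delta> \<le> b" "1 - \<eta> \<le> b" by (auto simp: a_def b_def)
      moreover have "\<mu> * (lam + \<delta> - 1) < \<delta>" by (rule jump_pos)
      moreover have "if lam * \<mu> \<ge> 1 then 0 \<le> (lam * \<mu> - 1) * (u - \<eta>)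
          \<and> (lam * \<mu> - 1) * (u - \<eta>) \<le> (lam * \<mu> - 1) * (1 - \<eta>)
        else (lam * \<mu> - 1) * (u - \<eta>) \<le> 0 \<and> (lam * \<mu> - 1) * (u - \<eta>) \<ge> (lam * \<mu> - 1) * (1 - \<eta>)"
        using False u by (auto simp: mult_left_mono mult_left_mono_neg mult_nonpos_nonneg)
      ultimately show ?thesis using eq one by (cases "lam * \<mu> \<ge> 1") (simp_all only: if_True if_False, linarith+)
    qed
    then show ?thesis by (simp add: F_def u_def) (simp add: frac_def)
  qed
  moreover have "0 < a" using delta_gt lam_less_1 eta_less_1 mu_pos by (simp add: a_def)
  moreover have "b < 1" using delta_less_1 eta_pos by (simp add: b_def)
  ultimately show ?thesis by blast
qed

lemma circ_lift_eq: "circ_lift lam \<mu> \<delta> = F"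
proof
  fix x
  have "\<mu> * (lam * x + \<delta> - 1) + 1 + (1 - lam * \<mu>) * of_int \<lfloor>x\<rfloor>
      = of_int \<lfloor>x\<rfloor> + (\<mu> * (lam * frac x + \<delta> - 1) + 1)"
    "lam * x + \<delta> + (1 - lam) * of_int \<lfloor>x\<rfloor> = of_int \<lfloor>x\<rfloor> + (lam * frac x + \<delta>)"
    by (simp_all add: frac_def algebra_simps)
  then show "circ_lift lam \<mu> \<delta> x = F x" by (simp add: circ_lift_def F_def T_def \<eta>_def)
qed

lemma circ_map_eq: assumes "x \<in> I01" shows "circ_map lam \<mu> \<delta> x = frac (F x)"
proof -
  have x: "frac x = x" "\<lfloor>x\<rfloor> = 0" using assms by (auto simp: frac_eq floor_eq_iff)
  then show ?thesis using floor_F[of x] by (simp add: frac_def) (auto simp: F_def T_def circ_map_def \<eta>_def x)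
qed

lemma frac_F_frac: "frac (F (frac x)) = frac (F x)"
  using F_add_int[of x "- \<lfloor>x\<rfloor>"] by (simp add: frac_def)

lemma circ_map_iter_frac: "(circ_map lam \<mu> \<delta> ^^ k) (frac x) = frac ((F ^^ k) x)"
  by (induction k) (auto simp: circ_map_eq frac_lt_1 frac_F_frac)

lemma circ_map_iter: "x \<in> I01 \<Longrightarrow> (circ_map lam \<mu> \<delta> ^^ k) x = frac ((F ^^ k) x)"
  using circ_map_iter_frac[of k x] frac_eq[of x] by simp

lemma circ_map_iter_in: "x \<in> I01 \<Longrightarrow> (circ_map lam \<mu> \<delta> ^^ k) x \<in> I01"
  by (simp add: circ_map_iter frac_lt_1)

lemma inj_on_circ_map: "inj_on (circ_map lam \<mu> \<delta>) I01"
proof (rule inj_onI)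
  fix x y assume xy: "x \<in> I01" "y \<in> I01" "circ_map lam \<mu> \<delta> x = circ_map lam \<mu> \<delta> y"
  have "F x + of_int (\<lfloor>F y\<rfloor> - \<lfloor>F x\<rfloor>) = F y" using xy by (simp add: circ_map_eq frac_def)
  then have "x + of_int (\<lfloor>F y\<rfloor> - \<lfloor>F x\<rfloor>) = y" using inj_F by (metis F_add_int injD)
  moreover have "\<lfloor>x\<rfloor> = 0" "\<lfloor>y\<rfloor> = 0" using xy by (simp_all add: floor_eq_iff)
  ultimately show "x = y" by (metis floor_add_int add_cancel_right_right of_int_0)
qed

section \<open>The rotation number as a cut of the rationals\<close>

lemma F_iter_ge_mult:
  fixes i :: int
  assumes "of_int i \<le> (F ^^ k) 0" shows "real n * of_int i \<le> (F ^^ (k * n)) 0"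
proof (induction n)
  case (Suc n)
  have "(F ^^ (k * n)) 0 + of_int i = (F ^^ (k * n)) (0 + of_int i)" by (simp only: F_iter_add_int)
  also have "\<dots> \<le> (F ^^ (k * n)) ((F ^^ k) 0)" using assms by (intro F_iter_mono) simp
  also have "\<dots> = (F ^^ (k * Suc n)) 0" by (metis add.commute comp_apply funpow_add mult_Suc_right)
  finally show ?case using Suc by (simp add: algebra_simps)
qed simp

lemma F_iter_le_mult:
  fixes i :: int
  assumes "(F ^^ k) 0 \<le> of_int i" shows "(F ^^ (k * n)) 0 \<le> real n * of_int i"
proof (induction n)
  case (Suc n)
  have "(F ^^ (k * Suc n)) 0 = (F ^^ (k * n)) ((F ^^ k) 0)"
    by (metis add.commute comp_apply funpow_add mult_Suc_right)
  also have "\<dots> \<le> (F ^^ (k * n)) (0 + of_int i)" using assms by (intro F_iter_mono) simp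
  also have "\<dots> = (F ^^ (k * n)) 0 + of_int i" by (simp only: F_iter_add_int)
  finally show ?case using Suc by (simp add: algebra_simps)
qed simp

text \<open>Both hypotheses, iterated up to the common time \<open>k * l\<close>, bound the same
  number.\<close>

lemma F_iter_compare:
  fixes i j :: int
  assumes "of_int i \<le> (F ^^ k) 0" "(F ^^ l) 0 \<le> of_int j"
  shows "real l * of_int i \<le> real k * of_int j"
  using F_iter_ge_mult[OF assms(1), of l] F_iter_le_mult[OF assms(2), of k]
  by (simp add: mult.commute)

definition rho :: real where "rho = rotation_number lam \<mu> \<delta>"

text \<open>\<open>x\<close> is compared with the integers around it, whose orbits are translates of
  the orbit of 0. The number \<open>r\<close> is left open because this estimate also serves to
  recognise \<open>r\<close> as the rotation number.\<close>

lemma F_iter_code_bound: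
  fixes r :: real
  assumes "\<And>k i::int. of_int i \<le> (F ^^ k) 0 \<Longrightarrow> of_int i \<le> real k * r"
    and "\<And>k i::int. (F ^^ k) 0 \<le> of_int i \<Longrightarrow> real k * r \<le> of_int i"
  shows "\<bar>of_int (\<lfloor>(F ^^ k) x\<rfloor> - \<lfloor>x\<rfloor>) - real k * r\<bar> \<le> 1"
proof -
  define i where "i = \<lfloor>(F ^^ k) 0\<rfloor>"
  have 1: "of_int i \<le> real k * r" using assms(1)[of i k] by (simp add: i_def)
  have 2: "real k * r \<le> of_int i + 1" using assms(2)[of k "i + 1"] by (simp add: i_def)
  have "(F ^^ k) 0 + \<lfloor>x\<rfloor> \<le> (F ^^ k) x"
    using F_iter_mono[of "0 + of_int \<lfloor>x\<rfloor>" x k] unfolding F_iter_add_int by simp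
  then have 3: "i + \<lfloor>x\<rfloor> \<le> \<lfloor>(F ^^ k) x\<rfloor>" unfolding i_def by linarith
  have "(F ^^ k) x < (F ^^ k) 0 + of_int (\<lfloor>x\<rfloor> + 1)"
    using F_iter_strict_mono[of x "0 + of_int (\<lfloor>x\<rfloor> + 1)" k] unfolding F_iter_add_int by simp
  then have 4: "\<lfloor>(F ^^ k) x\<rfloor> \<le> i + \<lfloor>x\<rfloor> + 1" unfolding i_def by linarith
  show ?thesis using 1 2 3 4 by linarith
qed

lemma F_iter_div_tendsto:
  fixes r :: real
  assumes "\<And>k i::int. of_int i \<le> (F ^^ k) 0 \<Longrightarrow> of_int i \<le> real k * r"
    and "\<And>k i::int. (F ^^ k) 0 \<le> of_int i \<Longrightarrow> real k * r \<le> of_int i"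
  shows "(\<lambda>k. (F ^^ k) x / real k) \<longlonglongrightarrow> r"
proof (rule LIM_zero_cancel, rule Lim_null_comparison)
  have "\<bar>(F ^^ k) x / real k - r\<bar> \<le> (\<bar>x\<bar> + 2) / real k" if "k > 0" for k
  proof -
    have "\<bar>(F ^^ k) x - x - real k * r\<bar> \<le> 2"
      using F_iter_code_bound[OF assms, of k x] by linarith
    then have "\<bar>(F ^^ k) x - real k * r\<bar> \<le> \<bar>x\<bar> + 2" by linarith
    moreover have "(F ^^ k) x / real k - r = ((F ^^ k) x - real k * r) / real k"
      using that by (simp add: field_simps)
    ultimately show ?thesis using that by (simp add: divide_right_mono)
  qed
  then show "\<forall>\<^sub>F k in sequentially. norm ((F ^^ k) x / real k - r) \<le> (\<bar>x\<bar> + 2) / real k"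
    by (intro eventually_sequentiallyI[of 1]) simp
  show "(\<lambda>k. (\<bar>x\<bar> + 2) / real k) \<longlonglongrightarrow> 0"
    by (intro tendsto_divide_0[OF tendsto_const] filterlim_at_top_imp_at_infinity filterlim_real_sequentially)
qed

lemma rho_eqI:
  fixes r :: real
  assumes "\<And>k i::int. of_int i \<le> (F ^^ k) 0 \<Longrightarrow> of_int i \<le> real k * r"
    and "\<And>k i::int. (F ^^ k) 0 \<le> of_int i \<Longrightarrow> real k * r \<le> of_int i"
  shows "rho = r"
  unfolding rho_def rotation_number_def circ_lift_eq
  using F_iter_div_tendsto[OF assms] LIMSEQ_unique by (intro the_equality) blast+

text \<open>The rotation number is the supremum of the fractions \<open>i / k\<close> with
  \<open>i\<close> below the \<open>k\<close>-th iterate of 0; by \<open>F_iter_compare\<close>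
  every fraction bounding the orbit from above is an upper bound of them.\<close>

lemma rotation_estimates:
  fixes i :: int
  shows "of_int i \<le> (F ^^ k) 0 \<Longrightarrow> of_int i \<le> real k * rho"
    and "(F ^^ k) 0 \<le> of_int i \<Longrightarrow> real k * rho \<le> of_int i"
proof -
  define S where "S = {of_int i / real k | i k. 0 < k \<and> of_int i \<le> (F ^^ k) 0}"
  have F0: "0 \<le> F 0" "F 0 \<le> 1" using delta_less_1 delta_gt lam_less_1 by (auto simp: F_def T_0)
  have ub: "s \<le> of_int j / real l" if "s \<in> S" "0 < l" "(F ^^ l) 0 \<le> of_int j" for s j l
    using that F_iter_compare[of _ _ l j] by (auto simp: S_def field_simps)
  have "S \<noteq> {}" using F0 by (auto simp: S_def intro!: exI[of _ 0] exI[of _ "1::nat"])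
  moreover have bdd: "bdd_above S" using ub[of _ 1 1] F0 by (intro bdd_aboveI[of _ 1]) auto
  ultimately have le: "Sup S \<le> of_int j / real l" if "0 < l" "(F ^^ l) 0 \<le> of_int j" for j l
    using ub[OF _ that] by (intro cSup_least) auto
  have 1: "of_int i \<le> real k * Sup S" if "of_int i \<le> (F ^^ k) 0" for i k
  proof (cases "k = 0")
    case False
    then have "of_int i / real k \<le> Sup S" using that bdd by (intro cSup_upper) (auto simp: S_def)
    then show ?thesis using False by (simp add: field_simps)
  qed (use that in simp)
  have 2: "real k * Sup S \<le> of_int i" if "(F ^^ k) 0 \<le> of_int i" for i k
    using le[of k i] that by (cases "k = 0") (auto simp: field_simps)
  have "rho = Sup S" using 1 2 by (rule rho_eqI)
  then show "of_int i \<le> (F ^^ k) 0 \<Longrightarrow> of_int i \<le> real k * rho"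
    and "(F ^^ k) 0 \<le> of_int i \<Longrightarrow> real k * rho \<le> of_int i"
    using 1 2 by auto
qed

lemmas code_bound = F_iter_code_bound[OF rotation_estimates]

lemma rho_pos: "0 < rho" and rho_less_1: "rho < 1"
proof -
  obtain a b where ab: "0 < a" "b < 1" "\<And>x. x + a \<le> F x" "\<And>x. F x \<le> x + b"
    using displacement_bounds by blast
  have 1: "real k * a \<le> (F ^^ k) 0" "(F ^^ k) 0 \<le> real k * b" for k
  proof (induction k)
    case (Suc k)
    { case 1 show ?case using Suc(1) ab(3)[of "(F ^^ k) 0"] by (simp add: algebra_simps)
    next case 2 show ?case using Suc(2) ab(4)[of "(F ^^ k) 0"] by (simp add: algebra_simps) }
  qed auto
  obtain k where "1 < real k * a" using reals_Archimedean3[OF ab(1)] by blast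
  then have "1 \<le> real k * rho" using rotation_estimates(1)[of 1 k] 1(1)[of k] by simp
  then show "0 < rho" by (metis less_le_not_le linorder_not_less mult_nonneg_nonpos of_nat_0_le_iff order_trans zero_less_one)
  obtain k where "1 < real k * (1 - b)" using reals_Archimedean3[of "1 - b"] ab(2) by auto
  then have "(F ^^ k) 0 \<le> of_int (int k - 1)" using 1(2)[of k] by (simp add: algebra_simps)
  from rotation_estimates(2)[OF this] have "0 < real k * (1 - rho)" by (simp add: algebra_simps)
  then show "rho < 1" by (simp add: zero_less_mult_iff)
qed

text \<open>For \<open>\<mu> > 1\<close> the distance of \<open>frac x\<close> to \<open>s = \<mu> / (\<mu> - 1)\<close>, which lies beyond 1, shrinks under
  \<open>F\<close> at most by the factors \<open>L\<close> and \<open>L * \<mu>\<close>, where \<open>L = 1 - \<delta> / s > lam\<close>; since it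
  stays bounded, \<open>L * \<mu> powr rho \<le> 1\<close>.\<close>

lemma lam_mu_powr_rho: "lam * \<mu> powr rho < 1"
proof (cases "\<mu> \<le> 1")
  case True
  then have "lam * \<mu> powr rho \<le> lam * 1"
    using rho_pos mu_pos lam_pos by (intro mult_left_mono powr_le1) auto
  then show ?thesis using lam_less_1 by simp
next
  case False
  define s where "s = \<mu> / (\<mu> - 1)"
  define L where "L = 1 - \<delta> / s"
  have mu: "\<mu> > 1" using False by simp
  \<comment> \<open>\<open>s\<close> is the fixed point of z -> \<open>\<mu> * (z - 1)\<close>, so
    this map multiplies distances to \<open>s\<close> by exactly \<open>\<mu>\<close>.\<close>
  have s: "s > 1" "s / \<mu> = s - 1" using mu by (auto simp: s_def field_simps)
  have Ls: "L * s = s - \<delta>" using s by (simp add: L_def field_simps)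
  \<comment> \<open>\<open>jump_pos\<close> amounts to \<open>lam < L\<close>, the source of
    strictness in the conclusion.\<close>
  have "\<delta> * (\<mu> - 1) < \<mu> * (1 - lam)" using jump_pos by (simp add: algebra_simps)
  then have "\<delta> < (1 - lam) * s" using mu by (simp add: s_def field_simps)
  then have "lam * s < L * s" using Ls by (simp add: algebra_simps)
  then have lamL: "lam < L" using s by simp
  then have L0: "0 < L" using lam_pos by simp
  have step: "L * \<mu> powi (\<lfloor>F x\<rfloor> - \<lfloor>x\<rfloor>) * (s - frac x) \<le> s - frac (F x)" for x
  proof -
    have fx: "0 \<le> frac x" by simp
    have "L * (s - frac x) = s - \<delta> - L * frac x" using Ls by (simp add: algebra_simps)
    also have "\<dots> \<le> s - \<delta> - lam * frac x" using mult_right_mono[OF less_imp_le[OF lamL] fx] by simp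
    finally have le: "L * (s - frac x) \<le> s - \<delta> - lam * frac x" .
    show ?thesis
    proof (cases "frac x < \<eta>")
      case True
      then have "frac (F x) = lam * frac x + \<delta>" using floor_F[of x] by (simp add: frac_def[of "F x"]) (simp add: F_def T_def)
      then show ?thesis using le True by (simp add: floor_F)
    next
      case False
      then have "frac (F x) = \<mu> * (lam * frac x + \<delta> - 1)" using floor_F[of x] by (simp add: frac_def[of "F x"]) (simp add: F_def T_def)
      then have "s - frac (F x) = \<mu> * (s / \<mu> - (lam * frac x + \<delta> - 1))"
        using mu by (simp add: right_diff_distrib)
      also have "\<dots> = \<mu> * (s - \<delta> - lam * frac x)" unfolding s(2) by (simp add: algebra_simps)
      also have "\<dots> \<ge> \<mu> * (L * (s - frac x))" using le mu by simp
      finally show ?thesis using False by (simp add: floor_F mult_ac)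
    qed
  qed
  have iter: "L ^ k * \<mu> powi \<lfloor>(F ^^ k) 0\<rfloor> * s \<le> s - frac ((F ^^ k) 0)" for k
  proof (induction k)
    case (Suc k)
    let ?x = "(F ^^ k) 0"
    have "L ^ Suc k * \<mu> powi \<lfloor>F ?x\<rfloor> * s
        = L * \<mu> powi (\<lfloor>F ?x\<rfloor> - \<lfloor>?x\<rfloor>) * (L ^ k * \<mu> powi \<lfloor>?x\<rfloor> * s)"
      using mu by (simp add: power_int_diff)
    also have "\<dots> \<le> L * \<mu> powi (\<lfloor>F ?x\<rfloor> - \<lfloor>?x\<rfloor>) * (s - frac ?x)"
      using Suc L0 mu by (intro mult_left_mono) auto
    also have "\<dots> \<le> s - frac (F ?x)" by (rule step)
    finally show ?case by simp
  qed simp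
  have bd: "(L * \<mu> powr rho) ^ k \<le> \<mu>" for k
  proof -
    have "L ^ k * \<mu> powi \<lfloor>(F ^^ k) 0\<rfloor> * s \<le> 1 * s" using iter[of k] by simp (smt (verit) frac_ge_0)
    then have "L ^ k * \<mu> powi \<lfloor>(F ^^ k) 0\<rfloor> \<le> 1" using s by (simp only: mult_le_cancel_right)
    moreover have "\<mu> powr (real k * rho - 1) \<le> \<mu> powr \<lfloor>(F ^^ k) 0\<rfloor>"
      using code_bound[of k 0] mu by (intro powr_mono) auto
    moreover have "\<mu> powi \<lfloor>(F ^^ k) 0\<rfloor> = \<mu> powr \<lfloor>(F ^^ k) 0\<rfloor>" using mu by (simp add: powr_real_of_int')
    ultimately have "L ^ k * \<mu> powr (real k * rho - 1) \<le> 1"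
      using L0 by (smt (verit) mult_left_mono zero_le_power)
    then have "L ^ k * \<mu> powr (real k * rho) \<le> \<mu>" using mu by (simp add: powr_diff field_simps)
    moreover have "(\<mu> powr rho) ^ k = \<mu> powr (real k * rho)"
      using mu by (simp add: powr_power mult.commute)
    ultimately show ?thesis by (simp add: power_mult_distrib)
  qed
  have "L * \<mu> powr rho \<le> 1"
  proof (rule ccontr)
    assume "\<not> ?thesis"
    then obtain k where "\<mu> < (L * \<mu> powr rho) ^ k" using real_arch_pow[of "L * \<mu> powr rho" \<mu>] by auto
    then show False using bd[of k] by simp
  qed
  moreover have "lam * \<mu> powr rho < L * \<mu> powr rho" using lamL mu by simp
  ultimately show ?thesis by simp
qed

end

section \<open>The function phi\<close>

text \<open>\<open>\<rho>\<close> is not tied to \<open>\<delta>\<close> here: for the boundary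
  value of \<open>\<delta>\<close>, properties of \<open>phi\<close> with parameter p/q are what
  identifies the rotation number.\<close>

locale phi_map = contracted_map +
  fixes \<rho> :: real
  assumes rot_pos: "0 < \<rho>" and rot_less_1: "\<rho> < 1" and contraction: "lam * \<mu> powr \<rho> < 1"
begin

definition phi :: "real \<Rightarrow> real" where "phi = phi_fun lam \<mu> \<delta> \<rho>"

text \<open>A bound for \<open>\<mu> powr d\<close> with d between -1 and 1, on whichever side of 1
  \<open>\<mu>\<close> lies.\<close>

definition M :: real where "M = \<mu> + 1 / \<mu>"

definition r :: real where "r = lam * \<mu> powr \<rho>"

lemma M_pos: "0 < M" using mu_pos by (simp add: M_def add_pos_pos)

lemma r_pos: "0 < r" and r_less_1: "r < 1"
  using lam_pos mu_pos contraction by (auto simp: r_def)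

lemma weight_pos: "0 < lam ^ k * \<mu> powi j"
  using lam_pos mu_pos by simp

lemma weight_le: assumes "\<bar>of_int j - real k * \<rho>\<bar> \<le> 1" shows "lam ^ k * \<mu> powi j \<le> M * r ^ k"
proof -
  define d where "d = of_int j - real k * \<rho>"
  have d: "-1 \<le> d" "d \<le> 1" using assms by (auto simp: d_def)
  have "\<mu> powr d \<le> M"
  proof (cases "\<mu> \<ge> 1")
    case True
    then have "\<mu> powr d \<le> \<mu> powr 1" using d by (intro powr_mono) auto
    also have "\<dots> \<le> M" using mu_pos by (simp add: M_def)
    finally show ?thesis .
  next
    case False
    then have "\<mu> powr d \<le> \<mu> powr (-1)" using d mu_pos by (intro powr_mono') auto
    also have "\<dots> \<le> M" using mu_pos by (simp add: M_def powr_minus_divide)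
    finally show ?thesis .
  qed
  moreover have "\<mu> powi j = \<mu> powr d * (\<mu> powr \<rho>) ^ k"
    using mu_pos by (simp add: d_def powr_real_of_int'[symmetric] powr_power powr_add[symmetric] mult.commute)
  ultimately show ?thesis
    using lam_pos mu_pos by (simp add: r_def power_mult_distrib mult_ac mult_left_mono mult_right_mono)
qed

lemma floor_shift: "\<lfloor>y + \<rho>\<rfloor> = \<lfloor>y\<rfloor> \<or> \<lfloor>y + \<rho>\<rfloor> = \<lfloor>y\<rfloor> + 1"
  using rot_pos rot_less_1 by linarith

lemma floor_diff_bound:
  fixes y c :: real
  shows "\<bar>of_int (\<lfloor>y\<rfloor> - \<lfloor>y - c\<rfloor>) - c\<bar> \<le> 1"
  by linarith

definition phi_term :: "real \<Rightarrow> nat \<Rightarrow> real" where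
  "phi_term y k = lam ^ k * \<mu> powi (\<lfloor>y\<rfloor> - \<lfloor>y - real k * \<rho>\<rfloor>)
     * (1 - \<eta> + of_int (\<lfloor>y - real (k + 1) * \<rho>\<rfloor> - \<lfloor>y - real k * \<rho>\<rfloor>))"

lemma phi_eq: "phi y = of_int \<lfloor>y\<rfloor> + \<eta> + (\<Sum>k. phi_term y k)"
proof -
  have "(lam + \<delta> - 1) / lam = 1 - \<eta>" using lam_pos by (simp add: \<eta>_def field_simps)
  then show ?thesis by (simp add: phi_def phi_fun_def phi_term_def \<eta>_def)
qed

lemma norm_phi_term_le: "norm (phi_term y k) \<le> M * r ^ k"
proof -
  let ?z = "y - real k * \<rho>"
  let ?c = "1 - \<eta> + of_int (\<lfloor>y - real (k + 1) * \<rho>\<rfloor> - \<lfloor>y - real k * \<rho>\<rfloor>)"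
  have eq: "y - real (k + 1) * \<rho> = ?z - \<rho>" by (simp add: algebra_simps)
  have "\<lfloor>?z - \<rho>\<rfloor> - \<lfloor>?z\<rfloor> \<in> {-1, 0}"
    using floor_shift[of "?z - \<rho>"] by auto
  then have "\<lfloor>y - real (k + 1) * \<rho>\<rfloor> - \<lfloor>?z\<rfloor> \<in> {-1, 0}" unfolding eq .
  then have "\<bar>?c\<bar> \<le> 1" using eta_pos eta_less_1 by auto
  moreover have "lam ^ k * \<mu> powi (\<lfloor>y\<rfloor> - \<lfloor>?z\<rfloor>) \<le> M * r ^ k"
    by (rule weight_le[OF floor_diff_bound])
  ultimately have "lam ^ k * \<mu> powi (\<lfloor>y\<rfloor> - \<lfloor>?z\<rfloor>) * \<bar>?c\<bar> \<le> M * r ^ k * 1"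
    using M_pos r_pos by (intro mult_mono[where b = "M * r ^ k"]) auto
  then show ?thesis using weight_pos[of k "\<lfloor>y\<rfloor> - \<lfloor>?z\<rfloor>"] lam_pos mu_pos by (simp add: phi_term_def abs_mult)
qed

lemma summable_geometric_bound: "summable (\<lambda>k. M * r ^ k)"
  using r_pos r_less_1 by (intro summable_mult summable_geometric) simp

lemma summable_phi_term: "summable (phi_term y)"
  using summable_comparison_test'[OF summable_geometric_bound, of 0 "phi_term y"] norm_phi_term_le by auto

text \<open>The tail of the series at \<open>y + \<rho>\<close> is the series at \<open>y\<close>
  multiplied by one branch slope.\<close>

lemma phi_shift:
  "phi (y + \<rho>) = of_int \<lfloor>y\<rfloor> + 1 + lam * \<mu> powi (\<lfloor>y + \<rho>\<rfloor> - \<lfloor>y\<rfloor>) * (phi y - of_int \<lfloor>y\<rfloor> - \<eta>)"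
proof -
  let ?w = "lam * \<mu> powi (\<lfloor>y + \<rho>\<rfloor> - \<lfloor>y\<rfloor>)"
  have "phi_term (y + \<rho>) (Suc k) = ?w * phi_term y k" for k
    using mu_pos by (simp add: phi_term_def algebra_simps power_int_add power_int_diff)
  then have "(\<Sum>k. phi_term (y + \<rho>) (Suc k)) = ?w * (\<Sum>k. phi_term y k)"
    by (simp add: suminf_mult[OF summable_phi_term])
  moreover have "phi_term (y + \<rho>) 0 = 1 - \<eta> + of_int (\<lfloor>y\<rfloor> - \<lfloor>y + \<rho>\<rfloor>)"
    by (simp add: phi_term_def)
  ultimately show ?thesis
    using suminf_split_head[OF summable_phi_term, of "y + \<rho>"] by (simp add: phi_eq)
qed

lemma phi_add_int: "phi (y + of_int n) = phi y + of_int n"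
proof -
  have "\<lfloor>y + of_int n - c\<rfloor> = \<lfloor>y - c\<rfloor> + n" for c
    using floor_add_int[of "y - c" n] by (simp add: algebra_simps)
  then have "phi_term (y + of_int n) = phi_term y" by (simp add: phi_term_def fun_eq_iff)
  then show ?thesis by (simp add: phi_eq)
qed

lemma phi_bounded: "\<exists>B>0. \<forall>y. \<bar>phi y - of_int \<lfloor>y\<rfloor>\<bar> \<le> B"
proof (intro exI conjI allI)
  fix y
  have "\<bar>\<Sum>k. phi_term y k\<bar> \<le> (\<Sum>k. M * r ^ k)"
    using norm_phi_term_le by (intro order_trans[OF summable_rabs] suminf_le
      summable_comparison_test'[OF summable_geometric_bound, of 0] summable_geometric_bound) auto
  then show "\<bar>phi y - of_int \<lfloor>y\<rfloor>\<bar> \<le> 1 + (\<Sum>k. M * r ^ k)"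
    using eta_pos eta_less_1 by (simp add: phi_eq)
  show "0 < 1 + (\<Sum>k. M * r ^ k)"
    using suminf_nonneg[OF summable_geometric_bound] M_pos r_pos by (simp add: add_pos_nonneg)
qed

text \<open>Both the orbits of \<open>F\<close> and the sequences \<open>phi (y + k * \<rho>)\<close> obey this recursion,
  with \<open>m\<close> their sequences of integer parts; two solutions with the same \<open>m\<close> approach each other.\<close>

lemma same_code_contraction:
  assumes "\<And>k. k < n \<Longrightarrow> X (Suc k) = of_int (m k) + 1 + lam * \<mu> powi (m (Suc k) - m k) * (X k - of_int (m k) - \<eta>)"
    and "\<And>k. k < n \<Longrightarrow> Y (Suc k) = of_int (m k) + 1 + lam * \<mu> powi (m (Suc k) - m k) * (Y k - of_int (m k) - \<eta>)"
  shows "X n - Y n = lam ^ n * \<mu> powi (m n - m 0) * (X 0 - Y 0)"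
  using assms
proof (induction n)
  case (Suc n)
  have "X (Suc n) - Y (Suc n) = lam * \<mu> powi (m (Suc n) - m n) * (X n - Y n)"
    using Suc.prems(1)[of n] Suc.prems(2)[of n] by (simp add: algebra_simps)
  also have "X n - Y n = lam ^ n * \<mu> powi (m n - m 0) * (X 0 - Y 0)" using Suc by simp
  finally show ?case using mu_pos by (simp add: power_int_diff)
qed simp

lemma phi_code_step:
  "phi (y + real (Suc k) * \<rho>) = of_int \<lfloor>y + real k * \<rho>\<rfloor> + 1
     + lam * \<mu> powi (\<lfloor>y + real (Suc k) * \<rho>\<rfloor> - \<lfloor>y + real k * \<rho>\<rfloor>) * (phi (y + real k * \<rho>) - of_int \<lfloor>y + real k * \<rho>\<rfloor> - \<eta>)"
  using phi_shift[of "y + real k * \<rho>"] by (simp add: algebra_simps)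

lemma code_close_to_phi:
  assumes "\<And>k. k < n \<Longrightarrow> X (Suc k) = of_int (m k) + 1 + lam * \<mu> powi (m (Suc k) - m k) * (X k - of_int (m k) - \<eta>)"
    and "\<And>k. k \<le> n \<Longrightarrow> m k = \<lfloor>y + real k * \<rho>\<rfloor>"
  shows "\<bar>X n - phi (y + real n * \<rho>)\<bar> \<le> M * r ^ n * \<bar>X 0 - phi y\<bar>"
proof -
  let ?Y = "\<lambda>k. phi (y + real k * \<rho>)"
  have "X n - ?Y n = lam ^ n * \<mu> powi (m n - m 0) * (X 0 - ?Y 0)"
    using assms phi_code_step by (intro same_code_contraction) simp_all
  moreover have "lam ^ n * \<mu> powi (m n - m 0) \<le> M * r ^ n"
  proof (rule weight_le)
    show "\<bar>of_int (m n - m 0) - real n * \<rho>\<bar> \<le> 1"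
      using assms(2)[of n] assms(2)[of 0] floor_diff_bound[of "y + real n * \<rho>" "real n * \<rho>"] by simp
  qed
  ultimately show ?thesis using lam_pos mu_pos
    by (simp add: abs_mult mult_right_mono)
qed

lemma geometric_bound_small: assumes "0 < e" shows "\<exists>N. \<forall>n\<ge>N. M * r ^ n * B < e"
proof -
  have "(\<lambda>n. M * r ^ n * B) \<longlonglongrightarrow> M * 0 * B"
    using r_pos r_less_1 by (intro tendsto_intros LIMSEQ_power_zero) simp
  then show ?thesis using assms by (auto simp: eventually_sequentially dest!: order_tendstoD(2)[where a = e])
qed

text \<open>Slightly to the right of \<open>y\<close> the integer parts agree with those of
  \<open>y\<close> along \<open>n\<close> backward rotation steps. Seen as ends of sequences started
  \<open>n\<close> steps earlier, the two values differ by at most \<open>M * r ^ n\<close> times a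
  constant. To the left the agreement fails if some \<open>y - real k * \<rho>\<close> is an
  integer.\<close>

lemma phi_right_cont: assumes "0 < e" shows "\<exists>d>0. \<forall>z. y \<le> z \<and> z < y + d \<longrightarrow> \<bar>phi z - phi y\<bar> < e"
proof -
  obtain B where B: "\<And>y. \<bar>phi y - of_int \<lfloor>y\<rfloor>\<bar> \<le> B" using phi_bounded by blast
  obtain n where n: "M * r ^ n * (2 * B) < e" using geometric_bound_small[OF assms] by blast
  define d where "d = Min ((\<lambda>k. 1 - frac (y - real k * \<rho>)) ` {..n})"
  have "0 < d" unfolding d_def by (subst Min_gr_iff) (auto simp: frac_lt_1)
  moreover have "\<bar>phi z - phi y\<bar> < e" if z: "y \<le> z" "z < y + d" for z
  proof -
    have fl: "\<lfloor>z - real k * \<rho>\<rfloor> = \<lfloor>y - real k * \<rho>\<rfloor>" if "k \<le> n" for k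
    proof -
      have "d \<le> 1 - frac (y - real k * \<rho>)" unfolding d_def using that by (intro Min_le) auto
      then show ?thesis
        using z of_int_floor_le[of "y - real k * \<rho>"] unfolding frac_def floor_eq_iff by (intro conjI; linarith)
    qed
    let ?y = "y - real n * \<rho>" and ?z = "z - real n * \<rho>"
    have fl': "\<lfloor>?z + real k * \<rho>\<rfloor> = \<lfloor>?y + real k * \<rho>\<rfloor>" if "k \<le> n" for k
      using fl[of "n - k"] that by (simp add: of_nat_diff algebra_simps)
    have "\<bar>phi (?z + real n * \<rho>) - phi (?y + real n * \<rho>)\<bar> \<le> M * r ^ n * \<bar>phi (?z + real 0 * \<rho>) - phi ?y\<bar>"
      using phi_code_step[of ?z] fl' by (intro code_close_to_phi[of n "\<lambda>k. phi (?z + real k * \<rho>)" "\<lambda>k. \<lfloor>?z + real k * \<rho>\<rfloor>"]) simp_all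
    also have "\<dots> \<le> M * r ^ n * (2 * B)"
      using B[of ?y] B[of ?z] fl[of n] M_pos r_pos by (intro mult_left_mono) auto
    finally show ?thesis using n by simp
  qed
  ultimately show ?thesis by blast
qed

end

section \<open>Rational parameter: \<open>phi\<close> as a step function\<close>

locale phi_map_rational = phi_map +
  fixes p q :: nat
  assumes q_pos: "0 < q" and rot_eq: "\<rho> = real p / real q" and coprime_pq: "coprime p q"
begin

lemma p_pos: "0 < p" and p_less_q: "p < q"
  using rot_pos rot_less_1 q_pos unfolding rot_eq by (auto simp: field_simps)

lemma q_times_shift: "real q * (y + real k * \<rho>) = real q * y + real (k * p)"
  using q_pos by (simp add: rot_eq field_simps)

lemma floor_shift_back: "\<lfloor>y - real k * \<rho>\<rfloor> = (\<lfloor>real q * y\<rfloor> - int (k * p)) div int q"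
proof -
  have "y - real k * \<rho> = (real q * y - real_of_int (int (k * p))) / real q"
    using q_pos by (simp add: rot_eq field_simps)
  then have "\<lfloor>y - real k * \<rho>\<rfloor> = \<lfloor>real q * y - of_int (int (k * p))\<rfloor> div int q"
    using floor_divide_real_eq_div[of "int q" "real q * y - of_int (int (k * p))"] by simp
  then show ?thesis by (simp only: floor_diff_of_int)
qed

lemma floor_div: "\<lfloor>y\<rfloor> = \<lfloor>real q * y\<rfloor> div int q"
  using floor_shift_back[of y 0] by simp

lemma phi_cong: assumes "\<lfloor>real q * y\<rfloor> = \<lfloor>real q * z\<rfloor>" shows "phi y = phi z"
proof -
  have "phi_term y = phi_term z"
    by (rule ext) (simp only: assms phi_term_def floor_shift_back floor_div[of y] floor_div[of z])
  then show ?thesis using assms floor_div[of y] floor_div[of z] by (simp add: phi_eq)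
qed

definition weight :: "nat \<Rightarrow> real" where "weight k = lam ^ k * \<mu> powi \<lfloor>real k * \<rho>\<rfloor>"

definition incr :: "nat \<Rightarrow> int" where "incr k = \<lfloor>real (k + 1) * \<rho>\<rfloor> - \<lfloor>real k * \<rho>\<rfloor>"

lemma incr_cases: "incr k = 0 \<or> incr k = 1"
  using floor_shift[of "real k * \<rho>"] by (auto simp: incr_def algebra_simps)

lemma weight_gt_0: "0 < weight k"
  unfolding weight_def by (rule weight_pos)

lemma summable_weight: "summable weight"
proof (rule summable_comparison_test'[OF summable_geometric_bound])
  fix k
  have "weight k \<le> M * r ^ k" unfolding weight_def by (rule weight_le) linarith
  then show "norm (weight k) \<le> M * r ^ k" using weight_gt_0[of k] by simp
qed

text \<open>\<open>\<mu> powi incr k\<close> is affine in \<open>incr k\<close>, which is 0 or 1.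
  Summing this linear recursion ties the sum of the weights to \<open>sigma_fun\<close>.\<close>

lemma weight_Suc: "weight (Suc k) = lam * weight k + lam * (\<mu> - 1) * (incr k * weight k)"
proof -
  have "weight (Suc k) = lam * \<mu> powi incr k * weight k"
    using mu_pos by (simp add: weight_def incr_def power_int_diff add.commute)
  then show ?thesis using incr_cases[of k] by (auto simp: algebra_simps)
qed

lemma summable_incr_weight: "summable (\<lambda>k. incr k * weight k)"
proof (rule summable_comparison_test'[OF summable_weight])
  show "norm (incr k * weight k) \<le> weight k" for k
    using incr_cases[of k] weight_gt_0[of k] by auto
qed

lemma sigma_fun_eq: "sigma_fun lam \<mu> \<rho> = (\<Sum>k. incr k * weight k)"
proof -
  have "incr 0 = 0" using rot_pos rot_less_1 by (simp add: incr_def floor_eq_iff)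
  then show ?thesis using suminf_split_head[OF summable_incr_weight]
    by (simp add: sigma_fun_def incr_def weight_def mult_ac)
qed

lemma suminf_weight: "(1 - lam) * (\<Sum>k. weight k) = 1 + lam * (\<mu> - 1) * sigma_fun lam \<mu> \<rho>"
proof -
  have "(\<Sum>k. weight k) = weight 0 + (\<Sum>k. weight (Suc k))"
    using suminf_split_head[OF summable_weight] by simp
  also have "(\<Sum>k. weight (Suc k)) = lam * (\<Sum>k. weight k) + lam * (\<mu> - 1) * sigma_fun lam \<mu> \<rho>"
    unfolding weight_Suc sigma_fun_eq
    by (simp add: suminf_add[symmetric] suminf_mult summable_weight summable_incr_weight summable_mult)
  finally show ?thesis by (simp add: weight_def algebra_simps)
qed

text \<open>For \<open>\<mu> < 1\<close> the sign is not obvious; \<open>lam\<close> times the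
  expression equals \<open>1 - lam\<close> times the sum of the weights without the first.\<close>

lemma denominator_pos: "0 < 1 + (\<mu> - 1) * sigma_fun lam \<mu> \<rho>"
proof -
  have "0 < (\<Sum>k. weight (Suc k))"
    using summable_weight weight_gt_0 by (intro suminf_pos) (simp_all add: summable_Suc_iff)
  then have "0 < (1 - lam) * ((\<Sum>k. weight k) - weight 0)"
    using suminf_split_head[OF summable_weight] lam_less_1 by simp
  also have "\<dots> = lam * (1 + (\<mu> - 1) * sigma_fun lam \<mu> \<rho>)"
    using suminf_weight by (simp add: weight_def algebra_simps)
  finally show ?thesis using lam_pos by (simp add: zero_less_mult_iff)
qed

text \<open>Since \<open>phi\<close> is constant on cells of length 1/q, \<open>- 1 / real q\<close>
  represents the left limit at 0. There the floors are
  \<open>- 1 - \<lfloor>real k * \<rho>\<rfloor>\<close>, which reduces the series to the sum of the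
  weights and \<open>sigma_fun\<close>.\<close>

lemma phi_before_0:
  "(1 - lam) * phi (- 1 / real q) = (1 + (\<mu> - 1) * sigma_fun lam \<mu> \<rho>) * (\<delta> - delta_fun lam \<mu> \<rho>)"
proof -
  let ?s = "sigma_fun lam \<mu> \<rho>"
  have div: "(- 1 - int a) div int q = - 1 - int a div int q" for a
  proof (rule int_div_pos_eq[where r = "int q - 1 - int a mod int q"])
    show "- 1 - int a = int q * (- 1 - int a div int q) + (int q - 1 - int a mod int q)"
      using mult_div_mod_eq[of "int q" "int a"] by (simp add: algebra_simps)
    show "0 \<le> int q - 1 - int a mod int q" "int q - 1 - int a mod int q < int q"
      using q_pos pos_mod_bound[of "int q" "int a"] pos_mod_sign[of "int q" "int a"] by linarith+
  qed
  have fl: "\<lfloor>- 1 / real q - real k * \<rho>\<rfloor> = - 1 - \<lfloor>real k * \<rho>\<rfloor>" for k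
  proof -
    have "\<lfloor>real k * \<rho>\<rfloor> = int (k * p) div int q"
      unfolding rot_eq times_divide_eq_right of_nat_mult[symmetric] by (rule floor_divide_of_nat_eq[unfolded of_nat_id, of "k * p" q, THEN trans]) (simp add: zdiv_int)
    moreover have "\<lfloor>real q * (- 1 / real q)\<rfloor> = - 1" using q_pos by (simp add: floor_eq_iff)
    ultimately show ?thesis unfolding floor_shift_back using div[of "k * p"] by simp
  qed
  have fl0: "\<lfloor>- 1 / real q\<rfloor> = - 1" using fl[of 0] by simp
  have "phi_term (- 1 / real q) k = (1 - \<eta>) * weight k - incr k * weight k" for k
    unfolding phi_term_def fl fl0 weight_def incr_def by (simp add: algebra_simps)
  then have sum: "(\<Sum>k. phi_term (- 1 / real q) k) = (1 - \<eta>) * (\<Sum>k. weight k) - ?s"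
    by (simp add: sigma_fun_eq suminf_diff[symmetric] suminf_mult summable_weight summable_incr_weight summable_mult)
  have "(1 - lam) * phi (- 1 / real q)
      = (1 - \<eta>) * ((1 - lam) * (\<Sum>k. weight k)) - (1 - lam) * (1 - \<eta>) - (1 - lam) * ?s"
    unfolding phi_eq fl0 sum by (simp add: algebra_simps)
  also have "\<dots> = (1 - \<eta>) * lam * (1 + (\<mu> - 1) * ?s) - (1 - lam) * ?s"
    unfolding suminf_weight by (simp add: algebra_simps)
  also have "(1 - \<eta>) * lam = lam + \<delta> - 1" using lam_eta by (simp add: algebra_simps)
  also have "(lam + \<delta> - 1) * (1 + (\<mu> - 1) * ?s) - (1 - lam) * ?s
      = (1 + (\<mu> - 1) * ?s) * \<delta> - (1 - lam) * (1 + \<mu> * ?s)" by (simp add: algebra_simps)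
  also have "\<dots> = (1 + (\<mu> - 1) * ?s) * (\<delta> - delta_fun lam \<mu> \<rho>)"
    using denominator_pos by (simp add: delta_fun_def right_diff_distrib)
  finally show ?thesis .
qed

end

text \<open>Bezout inverts \<open>p\<close> modulo \<open>q\<close>; adding \<open>K * q\<close>
  delays the time \<open>k\<close> without changing its residue.\<close>

lemma coprime_residue_hit:
  fixes p q K :: nat and a b :: int
  assumes "coprime p q" "0 < q"
  shows "\<exists>k\<ge>K. \<exists>i. a + int (k * p) - i * int q = b"
proof -
  obtain x v where "x * int p + v * int q = 1"
    using bezout_int[of "int p" "int q"] assms by (auto simp: coprime_iff_gcd_eq_1)
  then have "int p * x = 1 + int q * (- v)" by (simp add: algebra_simps)
  then obtain c where c: "int p * x = 1 + int q * c" by blast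
  define k where "k = nat ((x * (b - a)) mod int q) + K * q"
  have "\<exists>d. int k = x * (b - a) + int q * d"
  proof -
    have "int k = x * (b - a) - int q * ((x * (b - a)) div int q) + int q * int K"
      using assms pos_mod_sign[of "int q" "x * (b - a)"] by (simp add: k_def minus_mult_div_eq_mod)
    also have "\<dots> = x * (b - a) + int q * (int K - (x * (b - a)) div int q)" by (simp add: algebra_simps)
    finally show ?thesis by blast
  qed
  then obtain d where d: "int k = x * (b - a) + int q * d" by blast
  have "a + int (k * p) = a + (x * (b - a) + int q * d) * int p" by (simp add: d)
  also have "\<dots> = a + (int p * x) * (b - a) + int q * (d * int p)" by (simp add: algebra_simps)
  also have "\<dots> = b + (c * (b - a) + d * int p) * int q" by (simp only: c) (simp add: algebra_simps)
  finally have "a + int (k * p) - (c * (b - a) + d * int p) * int q = b" by simp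
  moreover have "K \<le> k" using assms(2) by (simp add: k_def trans_le_add2)
  ultimately show ?thesis by blast
qed

section \<open>Consequences of the closed range of \<open>phi\<close>\<close>

locale phi_map_range = phi_map +
  assumes phi_ge: "of_int \<lfloor>y\<rfloor> \<le> phi y" and phi_le: "phi y \<le> of_int \<lfloor>y\<rfloor> + 1"
begin

text \<open>The range at \<open>y + \<rho>\<close> decides on which side of \<open>\<eta>\<close>
  the argument of \<open>T\<close> lies, so the branch prescribed by the rotation is the one
  \<open>T\<close> uses; at \<open>\<eta>\<close> both agree.\<close>

lemma phi_shift_T: "phi (y + \<rho>) = of_int \<lfloor>y\<rfloor> + T (phi y - of_int \<lfloor>y\<rfloor>)"
proof -
  let ?u = "phi y - of_int \<lfloor>y\<rfloor> - \<eta>"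
  consider "\<lfloor>y + \<rho>\<rfloor> = \<lfloor>y\<rfloor>" | "\<lfloor>y + \<rho>\<rfloor> = \<lfloor>y\<rfloor> + 1" using floor_shift by blast
  then show ?thesis
  proof cases
    case 1
    then have "lam * ?u \<le> 0" using phi_shift[of y] phi_le[of "y + \<rho>"] by simp
    then have "?u \<le> 0" using lam_pos by (simp add: mult_le_0_iff)
    then show ?thesis using phi_shift[of y] 1 by (simp add: T_low)
  next
    case 2
    then have "0 \<le> lam * \<mu> * ?u" using phi_shift[of y] phi_ge[of "y + \<rho>"] by simp
    moreover have "0 < lam * \<mu>" using lam_pos mu_pos by simp
    ultimately have "0 \<le> ?u" using mult_pos_neg[of "lam * \<mu>" ?u] by linarith
    then show ?thesis using phi_shift[of y] 2 by (simp add: T_high)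
  qed
qed

lemma F_phi: "phi y < of_int \<lfloor>y\<rfloor> + 1 \<Longrightarrow> F (phi y) = phi (y + \<rho>)"
proof -
  assume "phi y < of_int \<lfloor>y\<rfloor> + 1"
  then have "\<lfloor>phi y\<rfloor> = \<lfloor>y\<rfloor>" using phi_ge[of y] by (simp add: floor_eq_iff)
  then show ?thesis by (simp add: phi_shift_T F_def frac_def)
qed

lemma phi_expands:
  assumes "y \<le> z" "phi y \<le> phi z" shows "\<kappa> * (phi z - phi y) \<le> phi (z + \<rho>) - phi (y + \<rho>)"
  using lift_lower_lipschitz[of "\<lfloor>y\<rfloor>" "\<lfloor>z\<rfloor>" "phi y - \<lfloor>y\<rfloor>" "phi z - \<lfloor>z\<rfloor>"]
    phi_ge[of y] phi_ge[of z] phi_le[of y] phi_le[of z] assms by (simp add: phi_shift_T floor_mono)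

text \<open>The discontinuity of \<open>F\<close> at the integers makes \<open>phi\<close> jump at the points \<open>N + k * \<rho>\<close>, \<open>k \<ge> 1\<close>.\<close>

lemma phi_jump:
  "\<exists>g>0. \<forall>y z (N::int). y < of_int N + real (Suc k) * \<rho> \<and> of_int N + real (Suc k) * \<rho> \<le> z \<longrightarrow> phi y + g \<le> phi z"
proof (induction k)
  case 0
  show ?case
  proof (intro exI conjI allI impI)
    show "0 < 1 + T 0 - T 1" using T_1_less by simp
    fix y z :: real and N :: int
    assume yz: "y < of_int N + real (Suc 0) * \<rho> \<and> of_int N + real (Suc 0) * \<rho> \<le> z"
    have "\<lfloor>y - \<rho>\<rfloor> < N" using yz by (simp add: floor_less_iff)
    moreover have "N \<le> \<lfloor>z - \<rho>\<rfloor>" using yz by (simp add: le_floor_iff)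
    moreover have "T (phi (y - \<rho>) - of_int \<lfloor>y - \<rho>\<rfloor>) \<le> T 1" using phi_le[of "y - \<rho>"] by (intro T_mono) simp
    moreover have "T 0 \<le> T (phi (z - \<rho>) - of_int \<lfloor>z - \<rho>\<rfloor>)" using phi_ge[of "z - \<rho>"] by (intro T_mono) simp
    ultimately show "phi y + (1 + T 0 - T 1) \<le> phi z"
      using phi_shift_T[of "y - \<rho>"] phi_shift_T[of "z - \<rho>"] by simp
  qed
next
  case (Suc k)
  then obtain g where g: "g > 0"
    "\<And>y z (N::int). y < of_int N + real (Suc k) * \<rho> \<Longrightarrow> of_int N + real (Suc k) * \<rho> \<le> z \<Longrightarrow> phi y + g \<le> phi z"
    by blast
  show ?case
  proof (intro exI conjI allI impI)
    show "0 < \<kappa> * g" using g kappa_pos by simp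
    fix y z :: real and N :: int
    assume yz: "y < of_int N + real (Suc (Suc k)) * \<rho> \<and> of_int N + real (Suc (Suc k)) * \<rho> \<le> z"
    then have le: "phi (y - \<rho>) + g \<le> phi (z - \<rho>)" by (intro g(2)[of _ N]) (simp_all add: algebra_simps)
    then have "\<kappa> * g \<le> \<kappa> * (phi (z - \<rho>) - phi (y - \<rho>))" using kappa_pos by simp
    also have "\<dots> \<le> phi z - phi y"
      using phi_expands[of "y - \<rho>" "z - \<rho>"] yz le g(1) by simp
    finally show "phi y + \<kappa> * g \<le> phi z" by simp
  qed
qed

end

context phi_map_rational
begin

lemma rational_rotation_hit: "\<exists>k\<ge>K. \<exists>i::int. \<lfloor>real q * (y + real k * \<rho> - of_int i)\<rfloor> = \<lfloor>real q * z\<rfloor>"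
proof -
  obtain k i where k: "K \<le> k" "\<lfloor>real q * y\<rfloor> + int (k * p) - i * int q = \<lfloor>real q * z\<rfloor>"
    using coprime_residue_hit[OF coprime_pq q_pos] by blast
  have "real q * (y + real k * \<rho> - of_int i) = real q * y + of_int (int (k * p) - i * int q)"
    using q_times_shift[of y k] by (simp add: algebra_simps)
  then have "\<lfloor>real q * (y + real k * \<rho> - of_int i)\<rfloor> = \<lfloor>real q * y\<rfloor> + (int (k * p) - i * int q)"
    by (simp only: floor_add_int)
  then show ?thesis using k by (intro exI[of _ k] conjI exI[of _ i]) simp_all
qed

lemma grid_le: "of_int \<lfloor>real q * y\<rfloor> / real q \<le> of_int (\<lfloor>y\<rfloor> + 1) - 1 / real q"
proof -
  have "\<lfloor>real q * y\<rfloor> \<le> int q * (\<lfloor>y\<rfloor> + 1) - 1"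
  proof -
    have "real q * y < real q * (of_int \<lfloor>y\<rfloor> + 1)" using q_pos by simp
    then have "real q * y < of_int (int q * (\<lfloor>y\<rfloor> + 1))" by simp
    then show ?thesis by (simp only: floor_less_iff[symmetric])
  qed
  then have "of_int \<lfloor>real q * y\<rfloor> \<le> real_of_int (int q * (\<lfloor>y\<rfloor> + 1) - 1)" by (simp only: of_int_le_iff)
  then have "of_int \<lfloor>real q * y\<rfloor> / real q \<le> real_of_int (int q * (\<lfloor>y\<rfloor> + 1) - 1) / real q"
    by (rule divide_right_mono) simp
  also have "\<dots> = of_int (\<lfloor>y\<rfloor> + 1) - 1 / real q" using q_pos by (simp add: diff_divide_distrib)
  finally show ?thesis .
qed

lemma phi_grid: "phi y = phi (of_int \<lfloor>real q * y\<rfloor> / real q)"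
  using q_pos by (intro phi_cong) simp

lemma phi_image_grid: "phi ` I01 = (\<lambda>m. phi (real m / real q)) ` {..<q}"
proof
  show "phi ` I01 \<subseteq> (\<lambda>m. phi (real m / real q)) ` {..<q}"
  proof
    fix x assume "x \<in> phi ` I01"
    then obtain y where y: "0 \<le> y" "y < 1" "x = phi y" by auto
    define m where "m = nat \<lfloor>real q * y\<rfloor>"
    have "real_of_int \<lfloor>real q * y\<rfloor> = real m" using y(1) by (simp add: m_def)
    then have "x = phi (real m / real q)" using phi_grid[of y] y(3) by simp
    moreover have "real q * y < real_of_int (int q)" using y(2) q_pos by simp
    then have "\<lfloor>real q * y\<rfloor> < int q" by (simp only: floor_less_iff)
    then have "m < q" using q_pos by (simp add: m_def nat_less_iff)
    ultimately show "x \<in> (\<lambda>m. phi (real m / real q)) ` {..<q}" by blast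
  qed
  show "(\<lambda>m. phi (real m / real q)) ` {..<q} \<subseteq> phi ` I01" using q_pos by auto
qed

end

section \<open>Boundary value of \<open>\<delta>\<close>: steps of \<open>phi\<close> and the
  rotation number\<close>

locale phi_map_degenerate = phi_map_rational +
  assumes phi_before_0_eq_0: "phi (- 1 / real q) = 0"
begin

text \<open>The height of the step of \<open>phi\<close> at the left end of the cell containing
  \<open>y\<close>.\<close>

definition D :: "real \<Rightarrow> real" where "D y = phi y - phi (y - 1 / real q)"

lemma D_cong: "\<lfloor>real q * y\<rfloor> = \<lfloor>real q * z\<rfloor> \<Longrightarrow> D y = D z"
proof -
  assume eq: "\<lfloor>real q * y\<rfloor> = \<lfloor>real q * z\<rfloor>"
  have "real q * (x - 1 / real q) = real q * x - 1" for x using q_pos by (simp add: field_simps)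
  then have "phi (y - 1 / real q) = phi (z - 1 / real q)" using eq by (intro phi_cong) simp
  then show ?thesis using phi_cong[OF eq] by (simp add: D_def)
qed

lemma D_add_int: "D (y + of_int n) = D y"
  using phi_add_int[of y n] phi_add_int[of "y - 1 / real q" n] by (simp add: D_def algebra_simps)

lemma phi_before_int: assumes "int q dvd \<lfloor>real q * y\<rfloor>" shows "phi (y - 1 / real q) = of_int \<lfloor>y\<rfloor>"
proof -
  have "\<lfloor>real q * (y - 1 / real q)\<rfloor> = \<lfloor>real q * y\<rfloor> - 1" using q_pos by (simp add: right_diff_distrib)
  moreover have "real q * (- 1 / real q + of_int \<lfloor>y\<rfloor>) = of_int (int q * \<lfloor>y\<rfloor> - 1)"
    using q_pos by (simp add: field_simps)
  moreover have "\<lfloor>real q * y\<rfloor> = int q * \<lfloor>y\<rfloor>" using assms floor_div[of y] by simp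
  ultimately have "phi (y - 1 / real q) = phi (- 1 / real q + of_int \<lfloor>y\<rfloor>)"
    by (intro phi_cong) (simp only: floor_of_int)
  then show ?thesis by (simp only: phi_add_int phi_before_0_eq_0)
qed

lemma floor_before: "\<lfloor>y - 1 / real q\<rfloor> = \<lfloor>y\<rfloor> - (if int q dvd \<lfloor>real q * y\<rfloor> then 1 else 0)"
proof -
  define j where "j = \<lfloor>real q * y\<rfloor>"
  have "\<lfloor>y - 1 / real q\<rfloor> = (j - 1) div int q"
    using floor_div[of "y - 1 / real q"] q_pos by (simp add: right_diff_distrib j_def)
  moreover have "(j - 1) div int q = j div int q - (if int q dvd j then 1 else 0)"
  proof (rule int_div_pos_eq[where r = "if int q dvd j then int q - 1 else j mod int q - 1"])
    show "j - 1 = int q * (j div int q - (if int q dvd j then 1 else 0)) + (if int q dvd j then int q - 1 else j mod int q - 1)"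
      using mult_div_mod_eq[of "int q" j] by (auto simp: algebra_simps)
    have m: "0 \<le> j mod int q" "j mod int q < int q" using q_pos by simp_all
    have "0 < j mod int q" if "\<not> int q dvd j"
    proof -
      have "j mod int q \<noteq> 0" using that by (simp add: dvd_eq_mod_eq_0)
      then show ?thesis using m by linarith
    qed
    then show "0 \<le> (if int q dvd j then int q - 1 else j mod int q - 1)"
      "(if int q dvd j then int q - 1 else j mod int q - 1) < int q"
      using q_pos m by simp_all
  qed
  ultimately show ?thesis by (simp add: floor_div[of y] j_def)
qed

text \<open>Neighbouring cells normally use the same branch. If the cell of \<open>y\<close> starts
  at an integer, its left neighbour has the value \<open>of_int \<lfloor>y\<rfloor>\<close> and
  moves by \<open>T 1\<close>, which adds the jump. If the cell of \<open>y + \<rho>\<close> starts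
  at an integer, the neighbour of \<open>y\<close> lies exactly \<open>\<eta>\<close> above
  \<open>of_int \<lfloor>y\<rfloor>\<close>, where the branches agree.\<close>

lemma D_shift_cases:
  "D (y + \<rho>) = lam * \<mu> powi (\<lfloor>y + \<rho>\<rfloor> - \<lfloor>y\<rfloor>) * D y + (if int q dvd \<lfloor>real q * y\<rfloor> then 1 + T 0 - T 1 else 0)"
proof -
  define j where "j = \<lfloor>real q * y\<rfloor>"
  let ?y = "y - 1 / real q"
  have j': "\<lfloor>real q * (y + \<rho>)\<rfloor> = j + int p"
    using q_times_shift[of y 1] by (simp add: j_def)
  \<comment> \<open>Hence the cells of \<open>y\<close> and \<open>y + \<rho>\<close> cannot both
    start at an integer.\<close>
  have np: "\<not> int q dvd int p" using p_pos p_less_q by (auto dest: nat_dvd_not_less)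
  have eq: "phi (y + \<rho> - 1 / real q) = phi (?y + \<rho>)" by (simp add: algebra_simps)
  have fl: "\<lfloor>?y + \<rho>\<rfloor> = \<lfloor>y + \<rho>\<rfloor> - (if int q dvd j + int p then 1 else 0)"
    using floor_before[of "y + \<rho>"] unfolding j' by (simp add: algebra_simps)
  consider "int q dvd j" "\<not> int q dvd j + int p" | "\<not> int q dvd j" "int q dvd j + int p"
    | "\<not> int q dvd j" "\<not> int q dvd j + int p" using np dvd_add_right_iff[of "int q" j "int p"] by blast
  then show ?thesis
  proof cases
    case 1
    have "\<lfloor>y + \<rho>\<rfloor> = \<lfloor>y\<rfloor>"
      using floor_div[of "y + \<rho>"] floor_div[of y] 1 p_less_q unfolding j' by (auto simp: j_def elim!: dvdE)
    moreover have "\<lfloor>?y\<rfloor> = \<lfloor>y\<rfloor> - 1" "phi ?y = of_int \<lfloor>y\<rfloor>"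
      using 1 floor_before[of y] phi_before_int[of y] by (simp_all add: j_def)
    ultimately have "phi (y + \<rho>) = of_int \<lfloor>y\<rfloor> + 1 + lam * (phi y - of_int \<lfloor>y\<rfloor> - \<eta>)"
      "phi (?y + \<rho>) = of_int \<lfloor>y\<rfloor> + lam * \<mu> * (1 - \<eta>)" "phi ?y = of_int \<lfloor>y\<rfloor>" "\<lfloor>y + \<rho>\<rfloor> = \<lfloor>y\<rfloor>"
      using 1 phi_shift[of y] phi_shift[of ?y] fl by simp_all
    moreover have "T 1 = 1 + lam * \<mu> * (1 - \<eta>)" "T 0 = 1 - lam * \<eta>"
      using T_high[of 1] eta_less_1 lam_eta by (simp_all add: T_0)
    ultimately show ?thesis using 1 by (simp add: D_def eq j_def[symmetric]) (simp add: algebra_simps)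
  next
    case 2
    have fe: "\<lfloor>?y + \<rho>\<rfloor> = \<lfloor>?y\<rfloor>" "\<lfloor>y + \<rho>\<rfloor> = \<lfloor>y\<rfloor> + 1" "\<lfloor>?y\<rfloor> = \<lfloor>y\<rfloor>"
      using fl floor_before[of y] 2 floor_shift[of y] floor_shift[of ?y] by (auto simp: j_def[symmetric])
    have v: "phi (?y + \<rho>) = of_int \<lfloor>y\<rfloor> + 1"
      using phi_before_int[of "y + \<rho>"] 2 fe unfolding j' eq by simp
    then have "lam * (phi ?y - of_int \<lfloor>y\<rfloor> - \<eta>) = 0" using phi_shift[of ?y] fe by simp
    then have "phi ?y = of_int \<lfloor>y\<rfloor> + \<eta>" using lam_pos by simp
    then show ?thesis using 2 phi_shift[of y] v fe
      by (simp add: D_def eq j_def[symmetric])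
  next
    case 3
    then show ?thesis using phi_shift[of y] phi_shift[of ?y] fl floor_before[of y]
      by (simp add: D_def eq j_def[symmetric]) (simp add: algebra_simps)
  qed
qed

lemma D_shift_ge: "lam * \<mu> powi (\<lfloor>y + \<rho>\<rfloor> - \<lfloor>y\<rfloor>) * D y \<le> D (y + \<rho>)"
  using D_shift_cases[of y] T_1_less by simp

lemma D_iter_ge: "lam ^ k * \<mu> powi (\<lfloor>y + real k * \<rho>\<rfloor> - \<lfloor>y\<rfloor>) * D y \<le> D (y + real k * \<rho>)"
proof (induction k)
  case (Suc k)
  let ?z = "y + real k * \<rho>"
  have e: "y + real (Suc k) * \<rho> = ?z + \<rho>" by (simp add: algebra_simps)
  have "lam ^ Suc k * \<mu> powi (\<lfloor>?z + \<rho>\<rfloor> - \<lfloor>y\<rfloor>) * D y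
      = lam * \<mu> powi (\<lfloor>?z + \<rho>\<rfloor> - \<lfloor>?z\<rfloor>) * (lam ^ k * \<mu> powi (\<lfloor>?z\<rfloor> - \<lfloor>y\<rfloor>) * D y)"
    using mu_pos by (simp add: power_int_diff)
  also have "\<dots> \<le> lam * \<mu> powi (\<lfloor>?z + \<rho>\<rfloor> - \<lfloor>?z\<rfloor>) * D ?z"
    using Suc lam_pos mu_pos by (intro mult_left_mono) auto
  also have "\<dots> \<le> D (?z + \<rho>)" by (rule D_shift_ge)
  finally show ?case unfolding e .
qed simp

text \<open>After \<open>q\<close> steps the rotation is back modulo 1, while the accumulated factor
  is \<open>r ^ q < 1\<close>; this is incompatible with a negative \<open>D y\<close>.\<close>

lemma D_nonneg: "0 \<le> D y"
proof -
  have e: "y + real q * \<rho> = y + of_int (int p)" using q_pos by (simp add: rot_eq)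
  have "\<lfloor>y + of_int (int p)\<rfloor> = \<lfloor>y\<rfloor> + int p" by (rule floor_add_int[symmetric])
  then have "lam ^ q * \<mu> ^ p * D y \<le> D y"
    using D_iter_ge[of q y] unfolding e D_add_int by simp
  moreover have "lam ^ q * \<mu> ^ p < 1"
  proof -
    have "(lam * \<mu> powr \<rho>) ^ q = lam ^ q * \<mu> powr (real p)"
      using mu_pos q_pos by (simp add: power_mult_distrib powr_power rot_eq)
    then have "lam ^ q * \<mu> ^ p = r ^ q" using mu_pos by (simp add: r_def powr_realpow)
    then show ?thesis using r_pos r_less_1 q_pos by (simp add: power_less_one_iff)
  qed
  ultimately show ?thesis using mult_strict_right_mono_neg[of "lam ^ q * \<mu> ^ p" 1 "D y"] by linarith
qed

text \<open>The jump makes \<open>D \<rho>\<close> positive, positivity propagates along the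
  rotation, and the rotation visits every cell.\<close>

lemma D_pos: "0 < D y"
proof -
  have "0 \<le> lam * \<mu> powi (\<lfloor>0 + \<rho>\<rfloor> - \<lfloor>0\<rfloor>) * D 0"
    using D_nonneg[of 0] lam_pos mu_pos by simp
  then have "0 < D (0 + \<rho>)" using D_shift_cases[of 0] T_1_less by simp
  then have pos: "0 < D (\<rho> + real k * \<rho>)" for k
    using less_le_trans[OF mult_pos_pos[OF weight_pos] D_iter_ge, of \<rho>] by simp
  obtain k i where "\<lfloor>real q * (\<rho> + real k * \<rho> - of_int i)\<rfloor> = \<lfloor>real q * y\<rfloor>"
    using rational_rotation_hit[of 0 \<rho> y] by blast
  from D_cong[OF this] have "D y = D (\<rho> + real k * \<rho>)"
    using D_add_int[of "\<rho> + real k * \<rho>" "- i"] by simp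
  then show ?thesis using pos by simp
qed

lemma phi_steps_mono: "phi y \<le> phi (y + real n / real q)"
proof (induction n)
  case (Suc n)
  have e: "y + real (Suc n) / real q - 1 / real q = y + real n / real q" by (simp add: add_divide_distrib)
  then show ?case using Suc D_nonneg[of "y + real (Suc n) / real q"] unfolding D_def e by linarith
qed simp

lemma phi_mono: assumes "y \<le> z" shows "phi y \<le> phi z"
proof -
  have le: "\<lfloor>real q * y\<rfloor> \<le> \<lfloor>real q * z\<rfloor>" using assms by (intro floor_mono mult_left_mono) auto
  define n where "n = nat (\<lfloor>real q * z\<rfloor> - \<lfloor>real q * y\<rfloor>)"
  have "real q * (y + real n / real q) = real q * y + of_int (\<lfloor>real q * z\<rfloor> - \<lfloor>real q * y\<rfloor>)"
    using q_pos le by (simp add: n_def field_simps)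
  then have "\<lfloor>real q * (y + real n / real q)\<rfloor> = \<lfloor>real q * z\<rfloor>" by (simp only: floor_add_int[symmetric])
  from phi_cong[OF this] show ?thesis using phi_steps_mono[of y n] by simp
qed

lemma phi_int_before: "phi (of_int N - 1 / real q) = of_int N"
  using phi_add_int[of "- 1 / real q" N] unfolding phi_before_0_eq_0 by simp

lemma phi_0_pos: "0 < phi 0"
  using D_pos[of 0] phi_before_0_eq_0 by (simp add: D_def)

sublocale phi_map_range lam \<mu> \<delta> \<rho>
proof unfold_locales
  fix y
  have "of_int \<lfloor>y\<rfloor> - 1 / real q \<le> y" using of_int_floor_le[of y] divide_nonneg_nonneg[of 1 "real q"] by linarith
  from phi_mono[OF this] show "of_int \<lfloor>y\<rfloor> \<le> phi y" by (simp only: phi_int_before)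
  from phi_mono[OF grid_le[of y]] have "phi (of_int \<lfloor>real q * y\<rfloor> / real q) \<le> of_int \<lfloor>y\<rfloor> + 1"
    by (simp only: phi_int_before)
  then show "phi y \<le> of_int \<lfloor>y\<rfloor> + 1" using phi_grid[of y] by simp
qed

text \<open>Together with \<open>F_iter_less_phi\<close> this traps the orbit of 0. Where
  \<open>phi\<close> takes the excluded upper end of its range, \<open>phi\<close> continues with
  \<open>T 1\<close> and \<open>F\<close> with the larger value after the jump.\<close>

lemma phi_le_F_iter: "phi (- 1 / real q + real k * \<rho>) \<le> (F ^^ k) 0"
proof (induction k)
  case 0
  then show ?case using phi_before_0_eq_0 by simp
next
  case (Suc k)
  let ?y = "- 1 / real q + real k * \<rho>"
  have "phi (?y + \<rho>) \<le> F (phi ?y)"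
  proof (cases "phi ?y < of_int \<lfloor>?y\<rfloor> + 1")
    case False
    then have "phi ?y = of_int (\<lfloor>?y\<rfloor> + 1)" using phi_le[of ?y] by simp
    then show ?thesis using phi_shift_T[of ?y] T_1_less by (simp add: F_def)
  qed (simp add: F_phi)
  also have "\<dots> \<le> F ((F ^^ k) 0)" using F_iter_mono[OF Suc, of 1] by simp
  finally show ?case by (simp add: algebra_simps)
qed

lemma F_iter_less_phi: "(F ^^ k) 0 < phi (real k * \<rho>)"
proof (induction k)
  case (Suc k)
  let ?y = "real k * \<rho>" and ?x = "(F ^^ k) 0"
  have "F ?x < phi (?y + \<rho>)"
  proof (cases "phi ?y < of_int \<lfloor>?y\<rfloor> + 1")
    case True then show ?thesis using F_strict_mono[OF Suc] by (simp add: F_phi)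
  next
    case False
    then have e: "phi ?y = of_int \<lfloor>?y\<rfloor> + 1" using phi_le[of ?y] by simp
    then have "\<lfloor>?x\<rfloor> \<le> \<lfloor>?y\<rfloor>" using Suc by (simp add: floor_le_iff)
    moreover have "T (frac ?x) < T 1"
      using T_lower_lipschitz[of "frac ?x" 1] mult_pos_pos[OF kappa_pos, of "1 - frac ?x"] frac_lt_1[of ?x] by simp
    ultimately show ?thesis using phi_shift_T[of ?y] e by (simp add: F_def)
  qed
  then show ?case by (simp add: algebra_simps)
qed (simp add: phi_0_pos)

text \<open>Both cut inequalities follow from the trapping of the orbit of 0. The shift by 1/q in
  the lower bound is affordable because an integer strictly below \<open>real k * \<rho>\<close> is
  at least 1/q below it.\<close>

lemma rho_eq: "rho = \<rho>"
proof (rule rho_eqI)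
  fix k and i :: int
  { assume "of_int i \<le> (F ^^ k) 0"
    then have "of_int i < of_int \<lfloor>real k * \<rho>\<rfloor> + (1::real)"
      using F_iter_less_phi[of k] phi_le[of "real k * \<rho>"] by linarith
    then have "i \<le> \<lfloor>real k * \<rho>\<rfloor>" by linarith
    then show "of_int i \<le> real k * \<rho>" by linarith }
  { assume le: "(F ^^ k) 0 \<le> of_int i"
    show "real k * \<rho> \<le> of_int i"
    proof (rule ccontr)
      assume "\<not> ?thesis"
      then have "real q * of_int i < real q * (real k * \<rho>)" using q_pos by simp
      also have "\<dots> = real (k * p)" using q_times_shift[of 0 k] by simp
      finally have "real_of_int (int q * i) < real_of_int (int (k * p))" by simp
      then have "int q * i < int (k * p)" by (simp only: of_int_less_iff)
      then have "int q * i + 1 \<le> int (k * p)" by simp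
      then have "of_int (int q * i + 1) \<le> real_of_int (int (k * p))" by (simp only: of_int_le_iff)
      then have "of_int i \<le> - 1 / real q + real k * \<rho>" using q_pos by (simp add: rot_eq field_simps)
      from phi_mono[OF this] have "phi (of_int i) \<le> of_int i" using phi_le_F_iter[of k] le by linarith
      then show False using phi_add_int[of 0 i] phi_0_pos by simp
    qed }
qed

end

section \<open>Integer parts of orbits\<close>

text \<open>The witness \<open>y\<close> is the supremum of \<open>m k - k * \<theta>\<close>; at most one \<open>k\<close> can fail.\<close>

lemma code_exists_irrational:
  fixes m :: "nat \<Rightarrow> int" and \<theta> :: real
  assumes irr: "\<theta> \<notin> \<rat>"
    and bound: "\<And>k n. \<bar>of_int (m (k + n) - m k) - real n * \<theta>\<bar> \<le> 1"
  shows "\<exists>y K. \<forall>k\<ge>K. m k = \<lfloor>y + real k * \<theta>\<rfloor>"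
proof -
  define b where "b k = of_int (m k) - real k * \<theta>" for k
  have diff: "b j \<le> b k + 1" for j k
  proof (cases "j \<le> k")
    case True then show ?thesis using bound[of j "k - j"] by (simp add: b_def of_nat_diff algebra_simps)
  next
    case False then show ?thesis using bound[of k "j - k"] by (simp add: b_def of_nat_diff algebra_simps)
  qed
  have inj: "j = k" if "b j = b k" for j k
  proof (rule ccontr)
    assume "j \<noteq> k"
    then have "\<theta> = of_int (m j - m k) / of_int (int j - int k)"
      using that by (simp add: b_def field_simps)
    then show False using irr by (metis Rats_divide Rats_of_int)
  qed
  define y where "y = Sup (range b)"
  have bdd: "bdd_above (range b)" using diff[of _ 0] by (intro bdd_aboveI2)
  have low: "b k \<le> y" for k unfolding y_def using bdd by (intro cSup_upper) auto
  have up: "y \<le> b k + 1" for k unfolding y_def using diff by (intro cSup_least) auto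
  have ex: "\<exists>K. \<forall>k\<ge>K. y \<noteq> b k + 1"
  proof (cases "\<exists>k0. y = b k0 + 1")
    case True
    then obtain k0 where k0: "y = b k0 + 1" by blast
    have "y \<noteq> b k + 1" if "Suc k0 \<le> k" for k using inj[of k k0] k0 that by auto
    then show ?thesis by blast
  qed auto
  then obtain K where K: "\<And>k. k \<ge> K \<Longrightarrow> y \<noteq> b k + 1" by blast
  have "m k = \<lfloor>y + real k * \<theta>\<rfloor>" if "k \<ge> K" for k
  proof -
    have "b k \<le> y" "y < b k + 1" using low[of k] up[of k] K[OF that] by auto
    then show ?thesis unfolding b_def by (intro floor_unique[symmetric]) auto
  qed
  then show ?thesis by blast
qed

text \<open>Where \<open>m (k + q)\<close> exceeds \<open>m k + p\<close>, at least 1 is gained and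
  never lost again within the residue class of \<open>k\<close> modulo \<open>q\<close>. Two such
  gains in one class would violate \<open>bound\<close>, so at most \<open>q\<close> indices are
  exceptional.\<close>

lemma eventually_periodic_code:
  fixes m :: "nat \<Rightarrow> int" and p :: int and q :: nat
  assumes "0 < q"
    and bound: "\<And>k n. m (k + n * q) - m k - int n * p \<le> 1"
    and mono: "\<And>k. m k + p \<le> m (k + q)"
  shows "\<exists>K. \<forall>k\<ge>K. m (k + q) = m k + p"
proof -
  define S where "S = {k. m (k + q) \<noteq> m k + p}"
  have mono': "m k + int n * p \<le> m (k + n * q)" for k n
  proof (induction n)
    case (Suc n) then show ?case using mono[of "k + n * q"] by (simp add: algebra_simps)
  qed simp
  have aux: False if "j < k" "j mod q = k mod q" "j \<in> S" "k \<in> S" for j k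
  proof -
    have "\<exists>n. k = j + q + n * q"
    proof -
      have "q dvd k - j" using that mod_eq_dvd_iff_nat[of j k q] by simp
      then obtain s where s: "k - j = q * s" by blast
      then have "s \<noteq> 0" using that by (intro notI) simp
      then have "k = j + q + (s - 1) * q" using s that by (cases s) (auto simp: algebra_simps)
      then show ?thesis by blast
    qed
    then obtain n where n: "k = j + q + n * q" by blast
    have "m j + p + 1 \<le> m (j + q)" "m k + p + 1 \<le> m (k + q)"
      using that mono[of j] mono[of k] by (auto simp: S_def)
    moreover have "m (j + q) + int n * p \<le> m k" unfolding n by (rule mono')
    moreover have e: "k + q = j + (n + 2) * q" unfolding n by simp
    have "m (k + q) - m j - int (n + 2) * p \<le> 1" unfolding e by (rule bound)
    ultimately show False by (simp add: algebra_simps)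
  qed
  have "inj_on (\<lambda>k. k mod q) S"
    by (intro inj_onI) (metis aux linorder_neqE_nat)
  moreover have "(\<lambda>k. k mod q) ` S \<subseteq> {..<q}" using assms(1) by auto
  ultimately have "finite S" by (meson finite_lessThan inj_on_finite)
  then obtain K where K: "\<forall>k\<in>S. k < K" unfolding finite_nat_set_iff_bounded by blast
  have "k \<notin> S" if "K \<le> k" for k using K that by auto
  then show ?thesis unfolding S_def by blast
qed

text \<open>\<open>sign\<close> makes the deviations \<open>b\<close> eventually periodic, and
  \<open>y\<close> is their maximum over a period. \<open>\<theta>\<close> may be negative, which
  serves backward orbits.\<close>

lemma code_exists_rational:
  fixes m :: "nat \<Rightarrow> int" and \<theta> :: real and p :: int and q :: nat
  assumes q: "0 < q" and cop: "coprime p (int q)" and theta: "\<theta> = of_int p / real q"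
    and bound: "\<And>k n. \<bar>of_int (m (k + n) - m k) - real n * \<theta>\<bar> \<le> 1"
    and sign: "(\<forall>k. m k + p \<le> m (k + q)) \<or> (\<forall>k. m (k + q) \<le> m k + p)"
  shows "\<exists>y K. \<forall>k\<ge>K. m k = \<lfloor>y + real k * \<theta>\<rfloor>"
proof -
  have ibound: "\<bar>m (k + n * q) - m k - int n * p\<bar> \<le> 1" for k n
  proof -
    have e: "real (n * q) * \<theta> = of_int (int n * p)" using q by (simp add: theta)
    have "\<bar>real_of_int (m (k + n * q) - m k - int n * p)\<bar> \<le> 1" using bound[of k "n * q"] unfolding e by simp
    then show ?thesis by linarith
  qed
  have "\<exists>K. \<forall>k\<ge>K. m (k + q) = m k + p"
  proof (cases "\<forall>k. m k + p \<le> m (k + q)")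
    case True
    have "m (k + n * q) - m k - int n * p \<le> 1" for k n using ibound[of k n] by linarith
    then show ?thesis using True q eventually_periodic_code[of q m p] by blast
  next
    case False
    have "- m (k + n * q) - - m k - int n * (- p) \<le> 1" for k n using ibound[of k n] by simp
    moreover have "- m k + - p \<le> - m (k + q)" for k
    proof -
      have "m (k + q) \<le> m k + p" using False sign by blast
      then show ?thesis by linarith
    qed
    ultimately obtain K where "\<forall>k\<ge>K. - m (k + q) = - m k + - p"
      using q eventually_periodic_code[of q "\<lambda>k. - m k" "- p"] by blast
    then show ?thesis by (intro exI[of _ K]) force
  qed
  then obtain K where per: "\<And>k. k \<ge> K \<Longrightarrow> m (k + q) = m k + p" by blast
  have per': "m (k + n * q) = m k + int n * p" if "k \<ge> K" for k n
  proof (induction n)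
    case (Suc n) then show ?case using per[of "k + n * q"] that by (simp add: algebra_simps)
  qed simp
  define b where "b k = of_int (m k) - real k * \<theta>" for k
  have b_per: "b (k + n * q) = b k" if "k \<ge> K" for k n
    using per'[OF that, of n] q by (simp add: b_def theta field_simps)
  define y where "y = Max (b ` {K..<K + q})"
  have "\<exists>j\<in>{K..<K + q}. b j = y"
  proof -
    have "Max (b ` {K..<K + q}) \<in> b ` {K..<K + q}" using q by (intro Max_in) auto
    then show ?thesis by (auto simp: y_def)
  qed
  then obtain j where j: "K \<le> j" "b j = y" by auto
  have low: "b k \<le> y" if "k \<ge> K" for k
  proof -
    define s where "s = K + (k - K) mod q"
    have "k = s + ((k - K) div q) * q" using that by (simp add: s_def)
    then have "b k = b s" using b_per[of s "(k - K) div q"] by (simp add: s_def)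
    moreover have "b s \<le> y" unfolding y_def using q by (intro Max_ge) (auto simp: s_def)
    ultimately show ?thesis by simp
  qed
  have up: "y < b k + 1" if "k \<ge> K" for k
  proof -
    define j' where "j' = j + k * q"
    have j': "b j' = y" "k \<le> j'"
      using b_per[OF j(1), of k] j q by (auto simp: j'_def intro: trans_le_add2)
    have le: "b j' \<le> b k + 1"
      using bound[of k "j' - k"] j'(2) by (simp add: b_def of_nat_diff algebra_simps)
    \<comment> \<open>Equality would make \<open>(j' - k) * \<theta>\<close> an integer, hence
      \<open>j' - k\<close> a multiple of \<open>q\<close>, and then periodicity gives
      \<open>b j' = b k\<close>.\<close>
    have "b j' \<noteq> b k + 1"
    proof
      assume eq: "b j' = b k + 1"
      have "real (j' - k) * \<theta> = of_int (m j' - m k - 1)"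
        using eq j'(2) by (simp add: b_def of_nat_diff algebra_simps)
      then have "real_of_int (int (j' - k) * p) = real_of_int ((m j' - m k - 1) * int q)"
        using q by (simp add: theta field_simps)
      then have "int (j' - k) * p = (m j' - m k - 1) * int q" by (simp only: of_int_eq_iff)
      then have "int q dvd int (j' - k) * p" by simp
      then have "int q dvd int (j' - k)" using cop by (simp add: coprime_commute coprime_dvd_mult_left_iff)
      then obtain n where n: "j' - k = q * n" by (auto simp: int_dvd_int_iff)
      have "j' = k + n * q" using n j'(2) by (simp add: mult.commute)
      then have "b j' = b k" using b_per[OF that, of n] by simp
      then show False using eq by simp
    qed
    then show ?thesis using le j' by simp
  qed
  have "m k = \<lfloor>y + real k * \<theta>\<rfloor>" if "k \<ge> K" for k
    using low[OF that] up[OF that] unfolding b_def by (intro floor_unique[symmetric]) auto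
  then show ?thesis by blast
qed

section \<open>Orbits of \<open>F\<close> followed by \<open>phi\<close>\<close>

locale phi_map_rotation = phi_map +
  assumes rot_eq_rho: "\<rho> = rho"
begin

lemma iter_code_bound: "\<bar>of_int (\<lfloor>(F ^^ n) x\<rfloor> - \<lfloor>x\<rfloor>) - real n * \<rho>\<bar> \<le> 1"
  using code_bound[of n x] by (simp add: rot_eq_rho)

lemma rational_cases:
  obtains "\<rho> \<notin> \<rat>" | p q :: nat where "0 < q" "coprime p q" "\<rho> = real p / real q"
proof (cases "\<rho> \<in> \<rat>")
  case True
  then obtain p q :: nat where "q \<noteq> 0" "\<bar>\<rho>\<bar> = real p / real q" "coprime p q" by (rule Rats_abs_nat_div_natE)
  then show thesis using that(2)[of q p] rot_pos by simp
qed (rule that(1))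

text \<open>In the rational case the sign condition holds because monotone iterates preserve the
  order of \<open>x + of_int (int p)\<close> and \<open>(F ^^ q) x\<close>.\<close>

lemma forward_code: "\<exists>y K. \<forall>k\<ge>K. \<lfloor>(F ^^ k) x\<rfloor> = \<lfloor>y + real k * \<rho>\<rfloor>"
proof -
  have bound: "\<bar>of_int (\<lfloor>(F ^^ (k + n)) x\<rfloor> - \<lfloor>(F ^^ k) x\<rfloor>) - real n * \<rho>\<bar> \<le> 1" for k n
    using iter_code_bound[of n "(F ^^ k) x"] by (simp add: funpow_add add.commute[of k])
  show ?thesis
  proof (cases rule: rational_cases)
    case 1
    then show ?thesis using bound by (rule code_exists_irrational)
  next
    case (2 p q)
    have iter: "(F ^^ (k + q)) x = (F ^^ k) ((F ^^ q) x)" for k by (simp add: funpow_add)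
    have iter': "(F ^^ k) x + of_int (int p) = (F ^^ k) (x + of_int (int p))" for k
      by (rule F_iter_add_int[symmetric])
    have "(\<forall>k. \<lfloor>(F ^^ k) x\<rfloor> + int p \<le> \<lfloor>(F ^^ (k + q)) x\<rfloor>) \<or> (\<forall>k. \<lfloor>(F ^^ (k + q)) x\<rfloor> \<le> \<lfloor>(F ^^ k) x\<rfloor> + int p)"
    proof (cases "x + of_int (int p) \<le> (F ^^ q) x")
      case True
      then show ?thesis unfolding floor_add_int iter iter' by (blast intro: floor_mono F_iter_mono)
    next
      case False
      then show ?thesis unfolding floor_add_int iter iter' by (intro disjI2 allI floor_mono F_iter_mono) simp
    qed
    with 2 bound show ?thesis
      by (intro code_exists_rational[of q "int p"]) simp_all
  qed
qed

text \<open>The same argument with \<open>- \<rho>\<close>: strict monotonicity of the iterates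
  carries the order of \<open>X q + of_int (int p)\<close> and \<open>X 0\<close> into the
  past.\<close>

lemma backward_code:
  assumes X: "\<And>k. F (X (Suc k)) = X k"
  shows "\<exists>y K. \<forall>k\<ge>K. \<lfloor>X k\<rfloor> = \<lfloor>y - real k * \<rho>\<rfloor>"
proof -
  have iter: "(F ^^ n) (X (k + n)) = X k" for n k
  proof (induction n arbitrary: k)
    case (Suc n) then show ?case using X[of k] Suc[of "Suc k"] by simp
  qed simp
  have bound: "\<bar>of_int (\<lfloor>X (k + n)\<rfloor> - \<lfloor>X k\<rfloor>) - real n * (- \<rho>)\<bar> \<le> 1" for k n
    using iter_code_bound[of n "X (k + n)"] unfolding iter by (simp add: abs_if split: if_splits)
  have "\<exists>y K. \<forall>k\<ge>K. \<lfloor>X k\<rfloor> = \<lfloor>y + real k * (- \<rho>)\<rfloor>"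
  proof (cases rule: rational_cases)
    case 1
    then have "- \<rho> \<notin> \<rat>" by (simp add: Rats_minus_iff)
    then show ?thesis using bound by (rule code_exists_irrational)
  next
    case (2 p q)
    have iter': "(F ^^ k) (X (k + q) + of_int (int p)) = X q + of_int (int p)" "(F ^^ k) (X k) = X 0" for k
      using iter[of k q] iter[of k 0] by (simp_all only: F_iter_add_int add.commute[of k] add_0)
    have fl: "\<lfloor>X (k + q)\<rfloor> = \<lfloor>X (k + q) + of_int (int p)\<rfloor> - int p" for k
      unfolding floor_add_int[symmetric] by simp
    have "(\<forall>k. \<lfloor>X k\<rfloor> + - int p \<le> \<lfloor>X (k + q)\<rfloor>) \<or> (\<forall>k. \<lfloor>X (k + q)\<rfloor> \<le> \<lfloor>X k\<rfloor> + - int p)"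
    proof (cases "X q + of_int (int p) \<le> X 0")
      case True
      have "X (k + q) + of_int (int p) \<le> X k" for k
        using F_iter_strict_mono[of "X k" "X (k + q) + of_int (int p)" k] True unfolding iter' by linarith
      then have fm: "\<lfloor>X (k + q) + of_int (int p)\<rfloor> \<le> \<lfloor>X k\<rfloor>" for k by (rule floor_mono)
      have "\<lfloor>X (k + q)\<rfloor> \<le> \<lfloor>X k\<rfloor> + - int p" for k using fl[of k] fm[of k] by linarith
      then show ?thesis by blast
    next
      case False
      have "X k \<le> X (k + q) + of_int (int p)" for k
        using F_iter_strict_mono[of "X (k + q) + of_int (int p)" "X k" k] False unfolding iter' by linarith
      then have fm: "\<lfloor>X k\<rfloor> \<le> \<lfloor>X (k + q) + of_int (int p)\<rfloor>" for k by (rule floor_mono)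
      have "\<lfloor>X k\<rfloor> + - int p \<le> \<lfloor>X (k + q)\<rfloor>" for k using fl[of k] fm[of k] by linarith
      then show ?thesis by blast
    qed
    moreover have "- \<rho> = of_int (- int p) / real q" using 2 by simp
    ultimately show ?thesis using 2 bound
      by (intro code_exists_rational[of q "- int p"]) simp_all
  qed
  then show ?thesis by simp
qed

lemma forward_orbit_close:
  "\<exists>y. (\<lambda>k. (F ^^ k) x - phi (y + real k * \<rho>)) \<longlonglongrightarrow> 0 \<and> (\<forall>\<^sub>F k in sequentially. \<lfloor>(F ^^ k) x\<rfloor> = \<lfloor>y + real k * \<rho>\<rfloor>)"
proof -
  obtain y K where yK: "\<And>k. k \<ge> K \<Longrightarrow> \<lfloor>(F ^^ k) x\<rfloor> = \<lfloor>y + real k * \<rho>\<rfloor>" using forward_code by blast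
  define z where "z = y + real K * \<rho>"
  define c where "c = \<bar>(F ^^ K) x - phi z\<bar>"
  have *: "\<bar>(F ^^ (K + n)) x - phi (y + real (K + n) * \<rho>)\<bar> \<le> M * r ^ n * c" for n
  proof -
    have "\<lfloor>(F ^^ (K + k)) x\<rfloor> = \<lfloor>z + real k * \<rho>\<rfloor>" for k
      using yK[of "K + k"] by (simp add: z_def algebra_simps)
    moreover have "(F ^^ (K + Suc k)) x = of_int \<lfloor>(F ^^ (K + k)) x\<rfloor> + 1
        + lam * \<mu> powi (\<lfloor>(F ^^ (K + Suc k)) x\<rfloor> - \<lfloor>(F ^^ (K + k)) x\<rfloor>) * ((F ^^ (K + k)) x - of_int \<lfloor>(F ^^ (K + k)) x\<rfloor> - \<eta>)" for k
      using F_eq[of "(F ^^ (K + k)) x"] by simp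
    ultimately have "\<bar>(F ^^ (K + n)) x - phi (z + real n * \<rho>)\<bar> \<le> M * r ^ n * \<bar>(F ^^ (K + 0)) x - phi z\<bar>"
      by (intro code_close_to_phi[where m = "\<lambda>k. \<lfloor>(F ^^ (K + k)) x\<rfloor>" and X = "\<lambda>k. (F ^^ (K + k)) x"])
    then show ?thesis by (simp add: z_def c_def algebra_simps)
  qed
  have "(\<lambda>n. M * r ^ n * c) \<longlonglongrightarrow> M * 0 * c"
    using r_pos r_less_1 by (intro tendsto_intros LIMSEQ_power_zero) simp
  then have lim: "(\<lambda>n. M * r ^ n * c) \<longlonglongrightarrow> 0" by simp
  have "(\<lambda>n. (F ^^ (n + K)) x - phi (y + real (n + K) * \<rho>)) \<longlonglongrightarrow> 0"
  proof (rule Lim_null_comparison[OF always_eventually lim], intro allI)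
    show "norm ((F ^^ (n + K)) x - phi (y + real (n + K) * \<rho>)) \<le> M * r ^ n * c" for n
      using *[of n] unfolding add.commute[of K n] real_norm_def .
  qed
  then have "(\<lambda>k. (F ^^ k) x - phi (y + real k * \<rho>)) \<longlonglongrightarrow> 0" by (rule LIMSEQ_offset)
  moreover have "\<forall>\<^sub>F k in sequentially. \<lfloor>(F ^^ k) x\<rfloor> = \<lfloor>y + real k * \<rho>\<rfloor>"
    using yK by (intro eventually_sequentiallyI)
  ultimately show ?thesis by blast
qed

text \<open>Equality rather than mere closeness: the contraction can be started arbitrarily far in
  the past, always with a bounded initial difference.\<close>

lemma backward_orbit_phi:
  assumes X: "\<And>k. F (X (Suc k)) = X k"
  shows "\<exists>y K. \<forall>k\<ge>K. \<lfloor>X k\<rfloor> = \<lfloor>y - real k * \<rho>\<rfloor> \<and> X k = phi (y - real k * \<rho>)"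
proof -
  obtain y K where yK: "\<And>k. k \<ge> K \<Longrightarrow> \<lfloor>X k\<rfloor> = \<lfloor>y - real k * \<rho>\<rfloor>" using backward_code[of X, OF X] by blast
  obtain B where B: "\<And>y. \<bar>phi y - of_int \<lfloor>y\<rfloor>\<bar> \<le> B" using phi_bounded by blast
  have "X k = phi (y - real k * \<rho>)" if k: "k \<ge> K" for k
  proof (rule ccontr)
    assume "X k \<noteq> phi (y - real k * \<rho>)"
    then obtain n where n: "M * r ^ n * (B + 1) < \<bar>X k - phi (y - real k * \<rho>)\<bar>"
      using geometric_bound_small[of "\<bar>X k - phi (y - real k * \<rho>)\<bar>"] by auto
    define z where "z = y - real (k + n) * \<rho>"
    define Z where "Z j = X (k + n - j)" for j
    have fl: "\<lfloor>Z j\<rfloor> = \<lfloor>z + real j * \<rho>\<rfloor>" if "j \<le> n" for j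
      using yK[of "k + n - j"] k that by (simp add: Z_def z_def of_nat_diff algebra_simps)
    have "F (Z j) = Z (Suc j)" if "j < n" for j
      using X[of "k + n - Suc j"] that by (simp add: Z_def Suc_diff_Suc)
    then have "\<bar>Z n - phi (z + real n * \<rho>)\<bar> \<le> M * r ^ n * \<bar>Z 0 - phi z\<bar>"
      using F_eq[of "Z _"] fl by (intro code_close_to_phi[where m = "\<lambda>k. \<lfloor>Z k\<rfloor>"]) (metis, simp)
    also have "\<dots> \<le> M * r ^ n * (B + 1)"
    proof (rule mult_left_mono)
      have "\<lfloor>Z 0\<rfloor> = \<lfloor>z\<rfloor>" using fl[of 0] by simp
      then show "\<bar>Z 0 - phi z\<bar> \<le> B + 1" using B[of z] by linarith
    qed (use M_pos r_pos in simp)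
    finally show False using n by (simp add: Z_def z_def algebra_simps)
  qed
  then show ?thesis using yK by blast
qed

lemma phi_recurrent:
  assumes "0 < e"
  shows "\<exists>k\<ge>K. \<exists>i::int. \<lfloor>y + real k * \<rho> - of_int i\<rfloor> = \<lfloor>z\<rfloor> \<and> \<bar>phi (y + real k * \<rho> - of_int i) - phi z\<bar> < e"
proof (cases rule: rational_cases)
  case 1
  obtain d where d: "0 < d" "\<And>x. z \<le> x \<Longrightarrow> x < z + d \<Longrightarrow> \<bar>phi x - phi z\<bar> < e"
    using phi_right_cont[OF assms] by blast
  \<comment> \<open>Hitting \<open>z + d'\<close> with error below \<open>d'\<close> stays to the
    right of \<open>z\<close>, where continuity is available, and below the next integer.\<close>
  define d' where "d' = min d (1 - frac z) / 2"
  have d': "0 < d'" "2 * d' \<le> d" "2 * d' \<le> 1 - frac z" using d(1) by (auto simp: d'_def frac_lt_1)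
  obtain h k :: int where hk: "0 < k" "\<bar>of_int k * \<rho> - of_int h - (z + d' - y - real K * \<rho>)\<bar> < d'"
    using sequence_of_fractional_parts_is_dense[OF 1 d'(1)] by blast
  define x where "x = y + real (K + nat k) * \<rho> - of_int h"
  have "x = y + real K * \<rho> + of_int k * \<rho> - of_int h" using hk(1) by (simp add: x_def algebra_simps)
  then have x: "z \<le> x" "x < z + 2 * d'" using hk(2) by linarith+
  have "\<lfloor>x\<rfloor> = \<lfloor>z\<rfloor>" using x d'(3) of_int_floor_le[of z] unfolding frac_def by (intro floor_unique) linarith+
  moreover have "\<bar>phi x - phi z\<bar> < e" using d(2)[of x] x d'(2) by linarith
  moreover have "K \<le> K + nat k" by simp
  ultimately show ?thesis unfolding x_def by blast
next
  case (2 p q)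
  interpret phi_map_rational lam \<mu> \<delta> \<rho> p q using 2 by unfold_locales
  obtain k i where k: "K \<le> k" "\<lfloor>real q * (y + real k * \<rho> - of_int i)\<rfloor> = \<lfloor>real q * z\<rfloor>"
    using rational_rotation_hit by blast
  have "\<bar>phi (y + real k * \<rho> - of_int i) - phi z\<bar> < e" using phi_cong[OF k(2)] assms by simp
  moreover have "\<lfloor>y + real k * \<rho> - of_int i\<rfloor> = \<lfloor>z\<rfloor>" 
    using k(2) floor_div[of "y + real k * \<rho> - of_int i"] floor_div[of z] by (simp only:)
  ultimately show ?thesis using k(1) by blast
qed

text \<open>\<open>F ^^ k\<close> of 0 has the same integer part as \<open>y + k * \<rho>\<close> and approaches \<open>phi (y + k * \<rho>)\<close>, which
  comes back close to every value of \<open>phi\<close> modulo integers.\<close>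

sublocale phi_map_range lam \<mu> \<delta> \<rho>
proof unfold_locales
  fix z
  obtain y where y: "(\<lambda>k. (F ^^ k) 0 - phi (y + real k * \<rho>)) \<longlonglongrightarrow> 0"
    "\<forall>\<^sub>F k in sequentially. \<lfloor>(F ^^ k) 0\<rfloor> = \<lfloor>y + real k * \<rho>\<rfloor>" using forward_orbit_close by blast
  have *: "of_int \<lfloor>z\<rfloor> - e \<le> phi z \<and> phi z \<le> of_int \<lfloor>z\<rfloor> + 1 + e" if e: "0 < e" for e
  proof -
    have "\<forall>\<^sub>F k in sequentially. \<bar>(F ^^ k) 0 - phi (y + real k * \<rho>)\<bar> < e / 2"
      using tendstoD[OF y(1), of "e / 2"] e by (simp add: dist_real_def)
    with y(2) have "\<forall>\<^sub>F k in sequentially. \<bar>(F ^^ k) 0 - phi (y + real k * \<rho>)\<bar> < e / 2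
        \<and> \<lfloor>(F ^^ k) 0\<rfloor> = \<lfloor>y + real k * \<rho>\<rfloor>" by eventually_elim simp
    then obtain K where K: "\<And>k. k \<ge> K \<Longrightarrow> \<bar>(F ^^ k) 0 - phi (y + real k * \<rho>)\<bar> < e / 2"
      "\<And>k. k \<ge> K \<Longrightarrow> \<lfloor>(F ^^ k) 0\<rfloor> = \<lfloor>y + real k * \<rho>\<rfloor>" unfolding eventually_sequentially by blast
    obtain k i where ki: "K \<le> k" "\<lfloor>y + real k * \<rho> - of_int i\<rfloor> = \<lfloor>z\<rfloor>"
      "\<bar>phi (y + real k * \<rho> - of_int i) - phi z\<bar> < e / 2"
      using phi_recurrent[OF half_gt_zero[OF e], of K y z] by blast
    have "phi (y + real k * \<rho> - of_int i) = phi (y + real k * \<rho>) - of_int i"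
      using phi_add_int[of "y + real k * \<rho>" "- i"] by simp
    moreover have "\<lfloor>z\<rfloor> = \<lfloor>(F ^^ k) 0\<rfloor> - i" using K(2)[OF ki(1)] ki(2) by simp
    ultimately show ?thesis using K(1)[OF ki(1)] ki(3) by linarith
  qed
  show "of_int \<lfloor>z\<rfloor> \<le> phi z"
  proof (rule field_le_epsilon)
    show "of_int \<lfloor>z\<rfloor> \<le> phi z + e" if "0 < e" for e using *[OF that] by linarith
  qed
  show "phi z \<le> of_int \<lfloor>z\<rfloor> + 1"
  proof (rule field_le_epsilon)
    show "phi z \<le> of_int \<lfloor>z\<rfloor> + 1 + e" if "0 < e" for e using *[OF that] by linarith
  qed
qed

text \<open>The orbit is asymptotic to \<open>phi\<close> along a rotation orbit, which puts limit
  points into the closure; recurrence makes every value of \<open>phi\<close> a limit point.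
  Equality of integer parts, not only closeness, is needed to pass from \<open>F\<close> to its
  fractional part.\<close>

lemma omega_limit_eq:
  assumes x: "x \<in> I01"
  shows "omega_limit (circ_map lam \<mu> \<delta>) x = closure (phi ` I01)"
proof -
  obtain y where y: "(\<lambda>k. (F ^^ k) x - phi (y + real k * \<rho>)) \<longlonglongrightarrow> 0"
    "\<forall>\<^sub>F k in sequentially. \<lfloor>(F ^^ k) x\<rfloor> = \<lfloor>y + real k * \<rho>\<rfloor>" using forward_orbit_close by blast
  define g where "g k = (circ_map lam \<mu> \<delta> ^^ k) x" for k
  have close: "\<exists>K. \<forall>k\<ge>K. \<bar>g k - phi (frac (y + real k * \<rho>))\<bar> < e" if e: "0 < e" for e
  proof -
    have "\<forall>\<^sub>F k in sequentially. \<bar>(F ^^ k) x - phi (y + real k * \<rho>)\<bar> < e"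
      using tendstoD[OF y(1) e] by (simp add: dist_real_def)
    with y(2) have "\<forall>\<^sub>F k in sequentially. \<bar>g k - phi (frac (y + real k * \<rho>))\<bar> < e"
    proof eventually_elim
      case (elim k)
      have "phi (frac (y + real k * \<rho>)) = phi (y + real k * \<rho>) - of_int \<lfloor>y + real k * \<rho>\<rfloor>"
        using phi_add_int[of "y + real k * \<rho>" "- \<lfloor>y + real k * \<rho>\<rfloor>"] by (simp add: frac_def)
      then show ?case using elim by (simp add: g_def circ_map_iter[OF x] frac_def)
    qed
    then show ?thesis by (simp add: eventually_sequentially)
  qed
  have frac_in: "frac t \<in> I01" for t :: real by (simp add: frac_lt_1)
  show ?thesis
  proof (intro set_eqI iffI)
    fix w assume w: "w \<in> omega_limit (circ_map lam \<mu> \<delta>) x"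
    show "w \<in> closure (phi ` I01)" unfolding closure_approachable
    proof (intro allI impI)
      fix e :: real assume e: "0 < e"
      obtain K where K: "\<And>k. k \<ge> K \<Longrightarrow> \<bar>g k - phi (frac (y + real k * \<rho>))\<bar> < e / 2"
        using close[OF half_gt_zero[OF e]] by blast
      have "w \<in> closure (\<Union>k\<in>{K..}. {g k})" using w by (auto simp: omega_limit_def g_def)
      then obtain k where k: "k \<ge> K" "dist (g k) w < e / 2"
        unfolding closure_approachable using half_gt_zero[OF e] by blast
      then have "dist (phi (frac (y + real k * \<rho>))) w < e" 
        using K[OF k(1)] k(2) unfolding dist_real_def by linarith
      then show "\<exists>v\<in>phi ` I01. dist v w < e" using frac_in by blast
    qed
  next
    have *: "phi z \<in> omega_limit (circ_map lam \<mu> \<delta>) x" if z: "z \<in> I01" for z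
    proof -
      have "phi z \<in> closure (\<Union>k\<in>{n..}. {g k})" for n
        unfolding closure_approachable
      proof (intro allI impI)
        fix e :: real assume e: "0 < e"
        obtain K where K: "\<And>k. k \<ge> K \<Longrightarrow> \<bar>g k - phi (frac (y + real k * \<rho>))\<bar> < e / 2"
          using close[OF half_gt_zero[OF e]] by blast
        obtain k i where ki: "max K n \<le> k" "\<lfloor>y + real k * \<rho> - of_int i\<rfloor> = \<lfloor>z\<rfloor>"
          "\<bar>phi (y + real k * \<rho> - of_int i) - phi z\<bar> < e / 2"
          using phi_recurrent[OF half_gt_zero[OF e], of "max K n" y z] by blast
        have k: "K \<le> k" "k \<in> {n..}" using ki(1) by simp_all
        have "\<lfloor>z\<rfloor> = 0" using z by (simp add: floor_eq_iff)
        then have fr: "y + real k * \<rho> - of_int i = frac (y + real k * \<rho>)" using ki(2) by (simp add: frac_def)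
        have "dist (g k) (phi z) < e"
          using K[OF k(1)] ki(3) unfolding fr dist_real_def by linarith
        then show "\<exists>v\<in>(\<Union>k\<in>{n..}. {g k}). dist v (phi z) < e" using k(2) by blast
      qed
      then show ?thesis by (simp add: omega_limit_def g_def)
    qed
    have "phi ` I01 \<subseteq> omega_limit (circ_map lam \<mu> \<delta>) x" using * by blast
    moreover have "closed (omega_limit (circ_map lam \<mu> \<delta>) x)"
      unfolding omega_limit_def by (intro closed_INT ballI closed_closure)
    ultimately have "closure (phi ` I01) \<subseteq> omega_limit (circ_map lam \<mu> \<delta>) x" by (rule closure_minimal)
    then show "w \<in> omega_limit (circ_map lam \<mu> \<delta>) x" if "w \<in> closure (phi ` I01)" for w using that by blast
  qed
qed

end

section \<open>Compact perfect sets of reals without interior are Cantor sets\<close>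

definition ternary :: "(nat \<Rightarrow> bool) \<Rightarrow> real" where
  "ternary d = (\<Sum>n. 2 * of_bool (d n) / 3 ^ Suc n)"

lemma geometric_third: "(\<lambda>n. 2 / 3 ^ Suc n :: real) sums 1"
  using sums_mult[OF geometric_sums[of "1 / 3 :: real"], of "2 / 3"] by (simp add: power_divide)

lemma summable_ternary: "summable (\<lambda>n. 2 * of_bool (d n) / 3 ^ Suc n :: real)"
  by (rule summable_comparison_test'[OF sums_summable[OF geometric_third], of 0]) (auto simp: of_bool_def)

lemma ternary_Suc: "ternary d = (2 * of_bool (d 0) + ternary (\<lambda>n. d (Suc n))) / 3"
proof -
  have "ternary (\<lambda>n. d (Suc n)) = (\<Sum>n. 3 * (2 * of_bool (d (Suc n)) / 3 ^ Suc (Suc n)))"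
    by (simp add: ternary_def)
  also have "\<dots> = 3 * (\<Sum>n. 2 * of_bool (d (Suc n)) / 3 ^ Suc (Suc n))"
    using summable_ternary[of d] by (intro suminf_mult) (subst summable_Suc_iff)
  also have "(\<Sum>n. 2 * of_bool (d (Suc n)) / 3 ^ Suc (Suc n)) = ternary d - 2 * of_bool (d 0) / 3"
    using suminf_split_head[OF summable_ternary, of d] by (simp add: ternary_def)
  finally show ?thesis by simp
qed

lemma ternary_nonneg: "0 \<le> ternary d" and ternary_le_1: "ternary d \<le> 1"
proof -
  show "0 \<le> ternary d" unfolding ternary_def by (intro suminf_nonneg summable_ternary) simp
  have "ternary d \<le> (\<Sum>n. 2 / 3 ^ Suc n)" unfolding ternary_def
    by (intro suminf_le summable_ternary sums_summable[OF geometric_third]) (auto simp: of_bool_def)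
  then show "ternary d \<le> 1" using sums_unique[OF geometric_third] by simp
qed

lemma ternary_close: "(\<And>k. k < n \<Longrightarrow> d k = e k) \<Longrightarrow> \<bar>ternary d - ternary e\<bar> \<le> 1 / 3 ^ n"
proof (induction n arbitrary: d e)
  case 0 show ?case using ternary_nonneg[of d] ternary_nonneg[of e] ternary_le_1[of d] ternary_le_1[of e] by simp
next
  case (Suc n)
  have "\<bar>ternary (\<lambda>n. d (Suc n)) - ternary (\<lambda>n. e (Suc n))\<bar> \<le> 1 / 3 ^ n" using Suc.prems by (intro Suc.IH) simp
  moreover have "d 0 = e 0" using Suc.prems by simp
  moreover have "\<bar>a / 3 - b / 3\<bar> = \<bar>a - b\<bar> / 3" for a b :: real by (simp add: diff_divide_distrib[symmetric] abs_divide)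
  ultimately show ?case by (simp add: ternary_Suc[of d] ternary_Suc[of e] add_divide_distrib)
qed

text \<open>The tails lie in [0, 1], so the first digit separates the values into [0, 1/3] and
  [2/3, 1].\<close>

lemma ternary_eq_head: "ternary d = ternary e \<Longrightarrow> d 0 = e 0 \<and> ternary (\<lambda>n. d (Suc n)) = ternary (\<lambda>n. e (Suc n))"
  using ternary_nonneg[of "\<lambda>n. d (Suc n)"] ternary_nonneg[of "\<lambda>n. e (Suc n)"]
    ternary_le_1[of "\<lambda>n. d (Suc n)"] ternary_le_1[of "\<lambda>n. e (Suc n)"]
  by (cases "d 0"; cases "e 0") (simp_all add: ternary_Suc[of d] ternary_Suc[of e])

lemma inj_ternary: "inj ternary"
proof (rule injI, rule ext)
  fix d e n assume "ternary d = ternary e"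
  then show "d n = e n"
  proof (induction n arbitrary: d e)
    case 0 then show ?case using ternary_eq_head by blast
  next
    case (Suc n)
    then show ?case using ternary_eq_head[of d e] Suc.IH[of "\<lambda>n. d (Suc n)" "\<lambda>n. e (Suc n)"] by simp
  qed
qed

lemma ternary_in_stage: "ternary d \<in> middle_thirds_stage n"
proof (induction n arbitrary: d)
  case (Suc n)
  show ?case using Suc[of "\<lambda>n. d (Suc n)"] by (cases "d 0") (auto simp: ternary_Suc[of d] add.commute)
qed (simp add: ternary_nonneg ternary_le_1)

lemma middle_thirds_stage_subset: "middle_thirds_stage n \<subseteq> {0..1}"
  by (induction n) auto

text \<open>Inverts the two contractions that build the stages; its iterates read off the ternary
  digits.\<close>

definition expand :: "real \<Rightarrow> real" where "expand t = (if t \<le> 1 / 3 then 3 * t else 3 * t - 2)"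

lemma expand_in_cantor: assumes "t \<in> middle_thirds_cantor" shows "expand t \<in> middle_thirds_cantor"
proof -
  have "expand t \<in> middle_thirds_stage n" for n
  proof -
    have "t \<in> middle_thirds_stage (Suc n)" using assms unfolding middle_thirds_cantor_def by blast
    then obtain x where x: "x \<in> middle_thirds_stage n" "t = x / 3 \<or> t = (x + 2) / 3" by auto
    moreover have "0 \<le> x" "x \<le> 1" using x(1) middle_thirds_stage_subset[of n] by auto
    moreover have "t = (x + 2) / 3 \<Longrightarrow> t \<le> 1 / 3 \<Longrightarrow> False" using \<open>0 \<le> x\<close> by simp
    ultimately have "expand t = x" by (auto simp: expand_def)
    then show ?thesis using x(1) by simp
  qed
  then show ?thesis by (simp add: middle_thirds_cantor_def)
qed

lemma range_ternary: "range ternary = middle_thirds_cantor"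
proof
  show "range ternary \<subseteq> middle_thirds_cantor" using ternary_in_stage by (auto simp: middle_thirds_cantor_def)
  show "middle_thirds_cantor \<subseteq> range ternary"
  proof
    fix t assume t: "t \<in> middle_thirds_cantor"
    define digits where "digits t n = (\<not> (expand ^^ n) t \<le> 1 / 3)" for t n
    have "\<bar>ternary (digits s) - s\<bar> \<le> 1 / 3 ^ n" if "s \<in> middle_thirds_cantor" for s n
      using that
    proof (induction n arbitrary: s)
      case 0
      have "s \<in> middle_thirds_stage 0" using 0 unfolding middle_thirds_cantor_def by blast
      then show ?case using ternary_nonneg[of "digits s"] ternary_le_1[of "digits s"] by auto
    next
      case (Suc n)
      have d: "digits s (Suc k) = digits (expand s) k" for k by (simp add: digits_def funpow_swap1)
      have "ternary (digits s) = (2 * of_bool (digits s 0) + ternary (digits (expand s))) / 3"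
        unfolding ternary_Suc[of "digits s"] d ..
      moreover have "s = (2 * of_bool (digits s 0) + expand s) / 3" by (simp add: digits_def expand_def)
      ultimately have "ternary (digits s) - s = (ternary (digits (expand s)) - expand s) / 3" by argo
      then show ?case using Suc.IH[OF expand_in_cantor[OF Suc.prems]] by simp
    qed
    note close = this[OF t]
    have "ternary (digits t) = t"
    proof (rule ccontr)
      assume "ternary (digits t) \<noteq> t"
      then obtain n where "(1 / 3) ^ n < \<bar>ternary (digits t) - t\<bar>"
        using real_arch_pow_inv[of "\<bar>ternary (digits t) - t\<bar>" "1 / 3"] by auto
      then show False using close[of n] by (simp add: power_divide)
    qed
    then show "t \<in> range ternary" using rangeI[of ternary "digits t"] by simp
  qed
qed

text \<open>Cutting at a gap that meets the middle third of a segment leaves two segments of at most two thirds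
  of its length; the sequence of left/right decisions identifies a point of \<open>S\<close>.\<close>

locale perfect_no_interval =
  fixes S :: "real set"
  assumes compact_S: "compact S" and nonempty: "S \<noteq> {}"
    and perfect: "\<And>x. x \<in> S \<Longrightarrow> x islimpt S"
    and no_interval: "\<And>a b. a < b \<Longrightarrow> \<not> {a<..<b} \<subseteq> S"
begin

text \<open>Accumulation from inside at both ends ensures that cutting at a gap never leaves a
  one-point segment.\<close>

definition good :: "real \<Rightarrow> real \<Rightarrow> bool" where
  "good a b \<longleftrightarrow> a < b \<and> a \<in> S \<and> b \<in> S
     \<and> (\<forall>e>0. \<exists>x\<in>S. a < x \<and> x < a + e) \<and> (\<forall>e>0. \<exists>x\<in>S. b - e < x \<and> x < b)"

lemma near_point:
  assumes "x \<in> S" "0 < e" obtains y where "y \<in> S" "y \<noteq> x" "\<bar>y - x\<bar> < e"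
  using perfect[OF assms(1)] assms(2) unfolding islimpt_approachable dist_real_def by blast

lemma right_limit:
  assumes "x \<in> S" "0 < h" "{x - h<..<x} \<inter> S = {}" "0 < e" shows "\<exists>y\<in>S. x < y \<and> y < x + e"
proof -
  obtain y where y: "y \<in> S" "y \<noteq> x" "\<bar>y - x\<bar> < min h e" using near_point[OF assms(1), of "min h e"] assms by auto
  then have "\<not> (x - h < y \<and> y < x)" using assms(3) by auto
  then have "x < y \<and> y < x + e" using y by linarith
  then show ?thesis using y(1) by blast
qed

lemma left_limit:
  assumes "x \<in> S" "0 < h" "{x<..<x + h} \<inter> S = {}" "0 < e" shows "\<exists>y\<in>S. x - e < y \<and> y < x"
proof -
  obtain y where y: "y \<in> S" "y \<noteq> x" "\<bar>y - x\<bar> < min h e" using near_point[OF assms(1), of "min h e"] assms by auto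
  then have "\<not> (x < y \<and> y < x + h)" using assms(3) by auto
  then have "x - e < y \<and> y < x" using y by linarith
  then show ?thesis using y(1) by blast
qed

lemma split_exists:
  assumes "good a b"
  shows "\<exists>l r. l < r \<and> {l<..<r} \<inter> S = {} \<and> good a l \<and> good r b \<and> l - a \<le> 2 / 3 * (b - a) \<and> b - r \<le> 2 / 3 * (b - a)"
proof -
  have ab: "a < b" "a \<in> S" "b \<in> S" using assms by (auto simp: good_def)
  have lim: "\<exists>x\<in>S. a < x \<and> x < a + e" "\<exists>x\<in>S. b - e < x \<and> x < b" if "0 < e" for e
    using assms that unfolding good_def by blast+
  define w where "w = (b - a) / 3"
  have w: "0 < w" "b = a + 3 * w" using ab by (simp_all add: w_def field_simps)
  then have "\<not> {a + w<..<b - w} \<subseteq> S" by (intro no_interval) simp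
  then obtain c where c: "a + w < c" "c < b - w" "c \<notin> S"
    unfolding subset_iff greaterThanLessThan_iff by blast
  have ac: "a < c" "c < b" using c w by auto
  have "compact (S \<inter> {a..c})" "compact (S \<inter> {c..b})" using compact_S by (auto intro: compact_Int)
  moreover have "S \<inter> {a..c} \<noteq> {}" "S \<inter> {c..b} \<noteq> {}" using ab ac by auto
  ultimately obtain l r where l: "l \<in> S \<inter> {a..c}" "\<forall>x\<in>S \<inter> {a..c}. x \<le> l"
    and r: "r \<in> S \<inter> {c..b}" "\<forall>x\<in>S \<inter> {c..b}. r \<le> x"
    using compact_attains_sup[of "S \<inter> {a..c}"] compact_attains_inf[of "S \<inter> {c..b}"] by blast
  have lc: "l < c" "c < r" using l(1) r(1) c(3) by (auto simp: le_less)
  have gap: "{l<..<r} \<inter> S = {}"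
  proof -
    have "x \<notin> S" if "l < x" "x < r" for x
    proof
      assume "x \<in> S"
      then show False using l r that by (cases "x \<le> c") force+
    qed
    then show ?thesis by auto
  qed
  obtain x where "x \<in> S" "a < x" "x < a + (c - a)" using lim(1)[of "c - a"] ac by auto
  then have al: "a < l" using l(2) by force
  obtain x where "x \<in> S" "b - (b - c) < x" "x < b" using lim(2)[of "b - c"] ac by auto
  then have rb: "r < b" using r(2) by force
  have "\<exists>y\<in>S. l - e < y \<and> y < l" if "0 < e" for e
    using l(1) lc gap that by (intro left_limit[of l "r - l"]) auto
  then have "good a l" using ab al l(1) lim(1) unfolding good_def by blast
  moreover have "\<exists>y\<in>S. r < y \<and> y < r + e" if "0 < e" for e
    using r(1) lc gap that by (intro right_limit[of r "r - l"]) auto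
  then have "good r b" using ab rb r(1) lim(2) unfolding good_def by blast
  moreover have "l - a \<le> 2 / 3 * (b - a)" "b - r \<le> 2 / 3 * (b - a)" using c lc w by auto
  moreover have "l < r" using lc by simp
  ultimately show ?thesis using gap by blast
qed

definition split :: "real \<times> real \<Rightarrow> real \<times> real" where
  "split I = (SOME lr. fst lr < snd lr \<and> {fst lr<..<snd lr} \<inter> S = {} \<and> good (fst I) (fst lr) \<and> good (snd lr) (snd I)
     \<and> fst lr - fst I \<le> 2 / 3 * (snd I - fst I) \<and> snd I - snd lr \<le> 2 / 3 * (snd I - fst I))"

lemma split:
  assumes "good (fst I) (snd I)"
  shows "fst (split I) < snd (split I)" "{fst (split I)<..<snd (split I)} \<inter> S = {}"
    "good (fst I) (fst (split I))" "good (snd (split I)) (snd I)"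
    "fst (split I) - fst I \<le> 2 / 3 * (snd I - fst I)" "snd I - snd (split I) \<le> 2 / 3 * (snd I - fst I)"
proof -
  have "\<exists>lr. fst lr < snd lr \<and> {fst lr<..<snd lr} \<inter> S = {} \<and> good (fst I) (fst lr) \<and> good (snd lr) (snd I)
     \<and> fst lr - fst I \<le> 2 / 3 * (snd I - fst I) \<and> snd I - snd lr \<le> 2 / 3 * (snd I - fst I)"
    unfolding split_paired_Ex fst_conv snd_conv by (rule split_exists[OF assms])
  from someI_ex[OF this, folded split_def]
  show "fst (split I) < snd (split I)" "{fst (split I)<..<snd (split I)} \<inter> S = {}"
    "good (fst I) (fst (split I))" "good (snd (split I)) (snd I)"
    "fst (split I) - fst I \<le> 2 / 3 * (snd I - fst I)" "snd I - snd (split I) \<le> 2 / 3 * (snd I - fst I)"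
    by blast+
qed

definition half :: "bool \<Rightarrow> real \<times> real \<Rightarrow> real \<times> real" where
  "half u I = (if u then (snd (split I), snd I) else (fst I, fst (split I)))"

primrec cell :: "(nat \<Rightarrow> bool) \<Rightarrow> nat \<Rightarrow> real \<times> real" where
  "cell d 0 = (Inf S, Sup S)"
| "cell d (Suc n) = half (d n) (cell d n)"

lemma Inf_in: "Inf S \<in> S" and Sup_in: "Sup S \<in> S" and Inf_le: "x \<in> S \<Longrightarrow> Inf S \<le> x" and le_Sup: "x \<in> S \<Longrightarrow> x \<le> Sup S"
proof -
  have bdd: "bdd_below S" "bdd_above S"
    using compact_imp_bounded[OF compact_S] by (auto intro: bounded_imp_bdd_below bounded_imp_bdd_above)
  show "Inf S \<in> S" using nonempty bdd compact_imp_closed[OF compact_S] by (intro closed_contains_Inf)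
  show "Sup S \<in> S" using nonempty bdd compact_imp_closed[OF compact_S] by (intro closed_contains_Sup)
  show "x \<in> S \<Longrightarrow> Inf S \<le> x" "x \<in> S \<Longrightarrow> x \<le> Sup S" using bdd by (auto intro: cInf_lower cSup_upper)
qed

lemma good_cell: "good (fst (cell d n)) (snd (cell d n))"
proof (induction n)
  case 0
  have gaps: "{Inf S - 1<..<Inf S} \<inter> S = {}" "{Sup S<..<Sup S + 1} \<inter> S = {}"
    using Inf_le le_Sup by force+
  have r: "\<exists>x\<in>S. Inf S < x \<and> x < Inf S + e" if "0 < e" for e
    by (rule right_limit[OF Inf_in zero_less_one gaps(1) that])
  have l: "\<exists>x\<in>S. Sup S - e < x \<and> x < Sup S" if "0 < e" for e
    by (rule left_limit[OF Sup_in zero_less_one gaps(2) that])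
  obtain x where "x \<in> S" "Inf S < x" using r[of 1] by auto
  then have "Inf S < Sup S" using le_Sup[of x] by simp
  then show ?case using r l Inf_in Sup_in by (simp add: good_def)
next
  case (Suc n)
  then show ?case using split(3,4)[OF Suc] by (simp add: half_def)
qed

lemma cell_length: "snd (cell d n) - fst (cell d n) \<le> (2 / 3) ^ n * (Sup S - Inf S)"
proof (induction n)
  case (Suc n)
  have "snd (cell d (Suc n)) - fst (cell d (Suc n)) \<le> 2 / 3 * (snd (cell d n) - fst (cell d n))"
    using split(5,6)[OF good_cell, of d n] by (simp add: half_def)
  also have "\<dots> \<le> 2 / 3 * ((2 / 3) ^ n * (Sup S - Inf S))" using Suc by simp
  finally show ?case by simp
qed simp

text \<open>The decisions come from the position of \<open>x\<close> here, whereas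
  \<open>cell\<close> takes them as given.\<close>

primrec path :: "real \<Rightarrow> nat \<Rightarrow> real \<times> real" where
  "path x 0 = (Inf S, Sup S)"
| "path x (Suc n) = half (fst (split (path x n)) < x) (path x n)"

definition code :: "real \<Rightarrow> nat \<Rightarrow> bool" where "code x n = (fst (split (path x n)) < x)"

lemma cell_code: "cell (code x) n = path x n"
  by (induction n) (simp_all add: code_def)

lemma good_path: "good (fst (path x n)) (snd (path x n))"
  using good_cell[of "code x" n] by (simp only: cell_code)

lemma split_left_or_right: assumes "x \<in> S" shows "x \<le> fst (split (path y n)) \<or> snd (split (path y n)) \<le> x"
proof (rule ccontr)
  assume "\<not> ?thesis"
  then have "x \<in> {fst (split (path y n))<..<snd (split (path y n))}" by simp
  then show False using split(2)[OF good_path] assms by blast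
qed

lemma mem_path: assumes "x \<in> S" shows "fst (path x n) \<le> x \<and> x \<le> snd (path x n)"
proof (induction n)
  case (Suc n)
  then show ?case using split_left_or_right[OF assms, of x n] by (auto simp: half_def not_less)
qed (simp add: Inf_le le_Sup assms)

lemma inj_on_code: "inj_on code S"
proof (rule inj_onI)
  fix x y assume xy: "x \<in> S" "y \<in> S" "code x = code y"
  have "path x n = path y n" for n using cell_code[of x n] cell_code[of y n] xy(3) by simp
  then have le: "\<bar>x - y\<bar> \<le> (2 / 3) ^ n * (Sup S - Inf S)" for n
    using mem_path[OF xy(1), of n] mem_path[OF xy(2), of n] cell_length[of "code x" n] cell_code[of x n]
    by (simp add: abs_le_iff)
  have "(\<lambda>n. (2 / 3) ^ n * (Sup S - Inf S)) \<longlonglongrightarrow> 0 * (Sup S - Inf S)"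
    by (intro tendsto_intros LIMSEQ_power_zero) simp
  then have "\<bar>x - y\<bar> \<le> 0 * (Sup S - Inf S)" using le by (intro LIMSEQ_le_const) blast+
  then show "x = y" by simp
qed

text \<open>Two points of \<open>S\<close> closer than the width of a gap lie on the same side of
  it. This is the continuity of the coding.\<close>

lemma code_locally_constant:
  assumes "x \<in> S"
  shows "\<exists>h>0. \<forall>y\<in>S. \<bar>y - x\<bar> < h \<longrightarrow> path y n = path x n \<and> (\<forall>k<n. code y k = code x k)"
proof (induction n)
  case 0 show ?case by (intro exI[of _ 1]) simp
next
  case (Suc n)
  then obtain h where h: "h > 0"
    "\<And>y. y \<in> S \<Longrightarrow> \<bar>y - x\<bar> < h \<Longrightarrow> path y n = path x n \<and> (\<forall>k<n. code y k = code x k)" by blast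
  let ?l = "fst (split (path x n))" and ?r = "snd (split (path x n))"
  have lr: "?l < ?r" by (rule split(1)[OF good_path])
  have "path y (Suc n) = path x (Suc n) \<and> (\<forall>k<Suc n. code y k = code x k)"
    if y: "y \<in> S" "\<bar>y - x\<bar> < min h (?r - ?l)" for y
  proof -
    have e: "path y n = path x n" "\<forall>k<n. code y k = code x k" using h(2) y by simp_all
    have "(?l < y) = (?l < x)"
      using split_left_or_right[OF assms, of x n] split_left_or_right[OF y(1), of x n] y(2) lr by linarith
    then show ?thesis using e by (simp add: code_def less_Suc_eq)
  qed
  then show ?case using h(1) lr by (intro exI[of _ "min h (?r - ?l)"]) simp
qed

text \<open>The left ends of the prescribed cells increase to a point of the closed set
  \<open>S\<close> that lies in all cells; the positive width of each gap makes its own decisions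
  the prescribed ones.\<close>

lemma code_surj: "\<exists>x\<in>S. code x = d"
proof -
  define a b where "a n = fst (cell d n)" and "b n = snd (cell d n)" for n
  have g: "good (a n) (b n)" for n using good_cell by (simp add: a_def b_def)
  have step: "a n \<le> a (Suc n)" "b (Suc n) \<le> b n" for n
    using split(1,3,4)[OF good_cell, of d n] by (auto simp: a_def b_def half_def good_def)
  have mono: "a m \<le> a n" "b n \<le> b m" if "m \<le> n" for m n
    using lift_Suc_mono_le[of a, OF step(1) that] lift_Suc_antimono_le[of b, OF step(2) that] by auto
  have ab: "a m \<le> b n" for m n
    using mono(1)[of m "max m n"] mono(2)[of n "max m n"] g[of "max m n"] by (simp add: good_def)
  define x where "x = Sup (range a)"
  have bdd: "bdd_above (range a)" using ab[of _ 0] by (intro bdd_aboveI2)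
  have ax: "a n \<le> x" for n unfolding x_def using bdd by (intro cSup_upper) auto
  have xb: "x \<le> b n" for n unfolding x_def using ab by (intro cSup_least) auto
  have "a \<longlonglongrightarrow> x" unfolding x_def using bdd mono(1) by (intro LIMSEQ_incseq_SUP) (auto simp: incseq_def)
  then have x: "x \<in> S"
    using closed_sequentially[OF compact_imp_closed[OF compact_S], of a x] g unfolding good_def by blast
  have decide: "(fst (split (cell d n)) < x) = d n" for n
    using ax[of "Suc n"] xb[of "Suc n"] split(1)[OF good_cell, of d n]
    by (cases "d n") (simp_all add: a_def b_def half_def)
  have path: "path x n = cell d n" for n
    by (induction n) (simp_all add: decide)
  have "code x = d" by (rule ext) (simp add: code_def path decide)
  then show ?thesis using x by blast
qed

theorem cantor_set: "cantor_set S"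
  unfolding cantor_set_def
proof (rule homeomorphic_compact)
  let ?g = "\<lambda>x. ternary (code x)"
  show "compact S" by (rule compact_S)
  have "d \<in> code ` S" for d using code_surj[of d] by blast
  then have "code ` S = UNIV" by blast
  then show "?g ` S = middle_thirds_cantor" using range_ternary image_image[of ternary code S] by simp
  show "inj_on ?g S" using comp_inj_on[OF inj_on_code inj_on_subset[OF inj_ternary subset_UNIV]] by (simp add: comp_def)
  show "continuous_on S ?g"
    unfolding continuous_on_iff
  proof (intro ballI allI impI)
    fix x e :: real assume x: "x \<in> S" and e: "0 < e"
    obtain n where n: "(1 / 3) ^ n < e" using real_arch_pow_inv[of e "1 / 3"] e by auto
    obtain h where h: "h > 0" "\<And>y. y \<in> S \<Longrightarrow> \<bar>y - x\<bar> < h \<Longrightarrow> \<forall>k<n. code y k = code x k"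
      using code_locally_constant[OF x, of n] by blast
    have "dist (?g y) (?g x) < e" if "y \<in> S" "dist y x < h" for y
      using ternary_close[of n "code y" "code x"] h(2)[of y] that n by (simp add: dist_real_def power_divide)
    then show "\<exists>d>0. \<forall>y\<in>S. dist y x < d \<longrightarrow> dist (?g y) (?g x) < e" using h(1) by blast
  qed
qed

end

section \<open>The limit set\<close>

context phi_map_rotation
begin

abbreviation f :: "real \<Rightarrow> real" where "f \<equiv> circ_map lam \<mu> \<delta>"

definition C :: "real set" where "C = (\<Inter>k\<in>{1..}. (f ^^ k) ` I01)"

lemma inj_on_f_iter: "inj_on (f ^^ k) I01"
proof (induction k)
  case (Suc k)
  show ?case
  proof (rule inj_onI)
    fix x y assume xy: "x \<in> I01" "y \<in> I01" "(f ^^ Suc k) x = (f ^^ Suc k) y"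
    then have "(f ^^ k) x = (f ^^ k) y"
      using inj_onD[OF inj_on_circ_map, of "(f ^^ k) x" "(f ^^ k) y"] circ_map_iter_in by simp
    then show "x = y" using inj_onD[OF Suc] xy by blast
  qed
qed simp

text \<open>A point of \<open>C\<close> has preimages of all orders; by injectivity they form one backward orbit.\<close>

lemma backward_orbit_exists:
  assumes "x \<in> C" shows "\<exists>X. X 0 = x \<and> (\<forall>k. F (X (Suc k)) = X k)"
proof -
  have "\<exists>z\<in>I01. (f ^^ Suc k) z = x" for k
  proof -
    have "x \<in> (f ^^ Suc k) ` I01" using assms unfolding C_def by (rule INT_D) simp
    then show ?thesis by blast
  qed
  then obtain w where w: "\<And>k. w k \<in> I01" "\<And>k. (f ^^ Suc k) (w k) = x" by metis
  define z where "z k = (case k of 0 \<Rightarrow> x | Suc j \<Rightarrow> w j)" for k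
  have x: "x \<in> I01" using circ_map_iter_in[OF w(1), of "Suc 0" 0] w(2)[of 0] by simp
  have z: "z k \<in> I01" "(f ^^ k) (z k) = x" for k using x w by (auto simp: z_def split: nat.split)
  have fz: "f (z (Suc k)) = z k" for k
  proof (rule inj_onD[OF inj_on_f_iter[of k]])
    show "(f ^^ k) (f (z (Suc k))) = (f ^^ k) (z k)" using z(2)[of k] z(2)[of "Suc k"] by (simp add: funpow_swap1)
    show "f (z (Suc k)) \<in> I01" using circ_map_iter_in[OF z(1), of "Suc 0" "Suc k"] by simp
  qed (rule z(1))
  have "\<exists>X. \<forall>n. (frac (X n) = z n \<and> (n = 0 \<longrightarrow> X n = x)) \<and> F (X (Suc n)) = X n"
  proof (rule dependent_nat_choice)
    show "\<exists>t. frac t = z 0 \<and> (0 = (0::nat) \<longrightarrow> t = x)" using x frac_eq[of x] by (simp add: z_def)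
    fix t n assume t: "frac t = z n \<and> (n = 0 \<longrightarrow> t = x)"
    \<comment> \<open>The integer translate of the preimage under \<open>f\<close> that
      \<open>F\<close> maps to \<open>t\<close> itself, not only modulo 1.\<close>
    define s where "s = z (Suc n) + of_int (\<lfloor>t\<rfloor> - \<lfloor>F (z (Suc n))\<rfloor>)"
    have "frac s = z (Suc n)" unfolding s_def using z(1)[of "Suc n"] frac_eq[of "z (Suc n)"] by (simp add: frac_def)
    moreover have "frac (F (z (Suc n))) = frac t" using circ_map_eq[OF z(1), of "Suc n"] fz t by simp
    then have "F s = t" unfolding s_def F_add_int by (simp add: frac_def)
    ultimately show "\<exists>s. (frac s = z (Suc n) \<and> (Suc n = 0 \<longrightarrow> s = x)) \<and> F s = t" by blast
  qed
  then show ?thesis by blast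
qed

lemma C_backward_phi:
  assumes "x \<in> C"
  shows "\<exists>X y K. (\<forall>k\<ge>K. \<lfloor>X k\<rfloor> = \<lfloor>y - real k * \<rho>\<rfloor> \<and> X k = phi (y - real k * \<rho>)) \<and> (\<forall>k. (F ^^ k) (X k) = x)"
proof -
  obtain X where X: "X 0 = x" "\<And>k. F (X (Suc k)) = X k" using backward_orbit_exists[OF assms] by blast
  obtain y K where "\<forall>k\<ge>K. \<lfloor>X k\<rfloor> = \<lfloor>y - real k * \<rho>\<rfloor> \<and> X k = phi (y - real k * \<rho>)"
    using backward_orbit_phi[of X, OF X(2)] by blast
  moreover have "(F ^^ k) (X k) = x" for k
    by (induction k) (simp_all add: X funpow_Suc_right del: funpow.simps(2))
  ultimately show ?thesis by blast
qed

lemma C_subset_I01: "C \<subseteq> I01"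
proof
  fix x assume "x \<in> C"
  then have "x \<in> (f ^^ 1) ` I01" unfolding C_def by (rule INT_D) simp
  then show "x \<in> I01" using circ_map_iter_in by blast
qed

end

section \<open>Conjugacy with the rotation\<close>

locale phi_map_conjugacy = phi_map_rotation +
  assumes phi_less: "phi y < of_int \<lfloor>y\<rfloor> + 1"
begin

lemma floor_phi: "\<lfloor>phi y\<rfloor> = \<lfloor>y\<rfloor>"
  using phi_ge[of y] phi_less[of y] by (simp add: floor_eq_iff)

lemma F_iter_phi: "(F ^^ k) (phi y) = phi (y + real k * \<rho>)"
  by (induction k) (simp_all add: F_phi[OF phi_less] algebra_simps)

lemma phi_in_I01: assumes "y \<in> I01" shows "phi y \<in> I01"
proof -
  have "\<lfloor>phi y\<rfloor> = 0" using assms unfolding floor_phi by (simp add: floor_eq_iff)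
  then show ?thesis by (simp add: floor_eq_iff)
qed

lemma frac_phi: "frac (phi y) = phi (frac y)"
  using phi_add_int[of y "- \<lfloor>y\<rfloor>"] by (simp add: frac_def floor_phi)

lemma f_iter_phi: "y \<in> I01 \<Longrightarrow> (f ^^ k) (phi y) = phi (frac (y + real k * \<rho>))"
  by (simp add: circ_map_iter[OF phi_in_I01] F_iter_phi frac_phi)

lemma f_phi: "y \<in> I01 \<Longrightarrow> f (phi y) = phi (rot \<rho> y)"
  using f_iter_phi[of y 1] by (simp add: rot_def)

text \<open>Rotating back \<open>k\<close> steps provides preimages of every order. Conversely, a
  backward orbit coincides with values of \<open>phi\<close> from time \<open>K\<close> on, and
  \<open>K\<close> applications of \<open>F\<close> carry this to time 0.\<close>

lemma C_eq: "C = phi ` I01"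
proof
  show "phi ` I01 \<subseteq> C" unfolding C_def
  proof (intro INT_greatest subsetI, elim imageE)
    fix k x y assume y: "y \<in> I01" "x = phi y"
    have "frac (y - real k * \<rho>) + real k * \<rho> = y + of_int (- \<lfloor>y - real k * \<rho>\<rfloor>)" by (simp add: frac_def)
    moreover have "frac (y + of_int (- \<lfloor>y - real k * \<rho>\<rfloor>)) = y" using y by (simp add: frac_def floor_eq_iff)
    moreover have "frac (y - real k * \<rho>) \<in> I01" by (simp add: frac_lt_1)
    ultimately have "(f ^^ k) (phi (frac (y - real k * \<rho>))) = x" using y by (simp add: f_iter_phi)
    then show "x \<in> (f ^^ k) ` I01" using phi_in_I01[of "frac (y - real k * \<rho>)"] by (auto simp: frac_lt_1)
  qed
  show "C \<subseteq> phi ` I01"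
  proof
    fix x assume x: "x \<in> C"
    obtain X y K where X: "\<forall>k\<ge>K. X k = phi (y - real k * \<rho>)" "(F ^^ K) (X K) = x"
      using C_backward_phi[OF x] by blast
    have "x = phi y" using X F_iter_phi[of K "y - real K * \<rho>"] by simp
    moreover have "\<lfloor>phi y\<rfloor> = 0" using C_subset_I01 x calculation by (auto simp: floor_eq_iff)
    then have "y \<in> I01" unfolding floor_phi by (simp add: floor_eq_iff)
    ultimately show "x \<in> phi ` I01" by blast
  qed
qed

end

section \<open>Irrational rotation number\<close>

locale phi_map_irrational = phi_map_rotation +
  assumes irrational: "\<rho> \<notin> \<rat>"
begin

lemma orbit_point_between:
  assumes "y < z" obtains k :: nat and N :: int where "y < of_int N + real (Suc k) * \<rho>" "of_int N + real (Suc k) * \<rho> \<le> z"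
proof -
  have e: "0 < (z - y) / 2" using assms by simp
  obtain h k :: int where hk: "0 < k" "\<bar>of_int k * \<rho> - of_int h - (y + z) / 2\<bar> < (z - y) / 2"
    using sequence_of_fractional_parts_is_dense[OF irrational e] by blast
  have "real (Suc (nat k - 1)) = of_int k" using hk(1) by simp
  moreover have "y < of_int (- h) + of_int k * \<rho>" "of_int (- h) + of_int k * \<rho> \<le> z"
    using hk(2) by (auto simp: abs_less_iff field_simps)
  ultimately show thesis using that[of "- h" "nat k - 1"] by simp
qed

text \<open>Between any two points lies some \<open>N + k * \<rho>\<close> with k at least 1, across
  which \<open>phi\<close> jumps upwards.\<close>

lemma phi_strict_mono: assumes "y < z" shows "phi y < phi z"
proof -
  obtain k N where "y < of_int N + real (Suc k) * \<rho>" "of_int N + real (Suc k) * \<rho> \<le> z"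
    using orbit_point_between[OF assms] by blast
  moreover obtain g where "g > 0" "\<forall>y z (N::int). y < of_int N + real (Suc k) * \<rho> \<and> of_int N + real (Suc k) * \<rho> \<le> z \<longrightarrow> phi y + g \<le> phi z"
    using phi_jump by blast
  ultimately have "phi y + g \<le> phi z" "0 < g" by blast+
  then show ?thesis by linarith
qed

sublocale phi_map_conjugacy lam \<mu> \<delta> \<rho>
proof unfold_locales
  fix y :: real
  obtain z where z: "y < z" "z < of_int \<lfloor>y\<rfloor> + 1"
    using dense[of y "of_int \<lfloor>y\<rfloor> + 1"] floor_correct[of y] by auto
  have "\<lfloor>z\<rfloor> = \<lfloor>y\<rfloor>" using z of_int_floor_le[of y] by (intro floor_unique) linarith+
  then show "phi y < of_int \<lfloor>y\<rfloor> + 1" using phi_strict_mono[OF z(1)] phi_le[of z] by simp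
qed

lemma phi_less_iff: "phi y < phi z \<longleftrightarrow> y < z"
  using phi_strict_mono[of y z] phi_strict_mono[of z y] by (metis linorder_neqE_linordered_idom less_asym less_irrefl)

lemma bij_betw_phi: "bij_betw phi I01 C"
proof -
  have "inj_on phi I01"
  proof (rule inj_onI)
    fix y z assume "phi y = phi z"
    then show "y = z" using phi_less_iff[of y z] phi_less_iff[of z y] by simp
  qed
  then show ?thesis by (simp add: bij_betw_def C_eq)
qed

lemma f_image_C: "f ` C = C"
proof -
  have "rot \<rho> ` I01 = I01"
  proof
    show "rot \<rho> ` I01 \<subseteq> I01" by (auto simp: rot_def frac_lt_1)
    show "I01 \<subseteq> rot \<rho> ` I01"
    proof
      fix y :: real assume y: "y \<in> I01"
      have "rot \<rho> (frac (y - \<rho>)) = frac (y + of_int (- \<lfloor>y - \<rho>\<rfloor>))" by (simp add: rot_def frac_def)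
      also have "\<dots> = y" using y by (simp add: frac_def floor_eq_iff)
      finally have "y = rot \<rho> (frac (y - \<rho>))" by simp
      then show "y \<in> rot \<rho> ` I01" by (rule image_eqI) (simp add: frac_lt_1)
    qed
  qed
  moreover have "(\<lambda>y. f (phi y)) ` I01 = (\<lambda>y. phi (rot \<rho> y)) ` I01" using f_phi by (rule image_cong[OF refl])
  moreover have "(\<lambda>y. phi (rot \<rho> y)) ` I01 = phi ` rot \<rho> ` I01" by (rule image_image[symmetric])
  moreover have "f ` phi ` I01 = (\<lambda>y. f (phi y)) ` I01" by (rule image_image)
  ultimately show ?thesis unfolding C_eq by simp
qed

lemma perfect_no_interval_closure: "perfect_no_interval (closure (phi ` I01))"
proof
  let ?A = "phi ` I01"
  have "bounded ?A" using phi_in_I01 by (intro bounded_subset[OF bounded_closed_interval[of 0 1]]) force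
  then show "compact (closure ?A)" by simp
  show "closure ?A \<noteq> {}" by simp
  show "x islimpt closure ?A" if x: "x \<in> closure ?A" for x
  proof (cases "x \<in> ?A")
    case False
    then have "x islimpt ?A" using x by (simp add: closure_def)
    then show ?thesis by (rule islimpt_subset) (rule closure_subset)
  next
    case True
    then obtain y where y: "y \<in> I01" "x = phi y" by blast
    have "x islimpt ?A" unfolding islimpt_approachable
    proof (intro allI impI)
      fix e :: real assume "0 < e"
      then obtain d where d: "0 < d" "\<And>z. y \<le> z \<Longrightarrow> z < y + d \<Longrightarrow> \<bar>phi z - phi y\<bar> < e"
        using phi_right_cont by blast
      define z where "z = y + min (d / 2) ((1 - y) / 2)"
      have z: "y < z" "z < y + d" "z < 1" using d(1) y by (auto simp: z_def min_def field_simps)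
      have "phi z \<in> ?A" using z y by auto
      moreover have "phi z \<noteq> x" using phi_strict_mono[OF z(1)] y by simp
      moreover have "dist (phi z) x < e" using d(2)[of z] z y by (simp add: dist_real_def)
      ultimately show "\<exists>x'\<in>?A. x' \<noteq> x \<and> dist x' x < e" by blast
    qed
    then show ?thesis by (rule islimpt_subset) (rule closure_subset)
  qed
  show "\<not> {a<..<b} \<subseteq> closure ?A" if ab: "a < b" for a b
  proof
    assume sub: "{a<..<b} \<subseteq> closure ?A"
    have hit: "\<exists>y\<in>I01. c < phi y \<and> phi y < d" if "c < d" "a \<le> c" "d \<le> b" for c d
    proof -
      have "(c + d) / 2 \<in> {c<..<d}" using that by (simp add: field_simps)
      moreover have "{c<..<d} \<subseteq> closure ?A" using sub that by force
      ultimately have "{c<..<d} \<inter> closure ?A \<noteq> {}" by blast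
      then have "{c<..<d} \<inter> ?A \<noteq> {}" by (simp add: open_Int_closure_eq_empty)
      then show ?thesis by auto
    qed
    obtain y z where yz: "a < phi y" "phi y < (a + b) / 2" "(a + b) / 2 < phi z" "phi z < b"
      using hit[of a "(a + b) / 2"] hit[of "(a + b) / 2" b] ab by (auto simp: field_simps)
    then have "phi y < phi z" by linarith
    then have "y < z" using phi_less_iff by simp
    then obtain k N where kN: "y < of_int N + real (Suc k) * \<rho>" "of_int N + real (Suc k) * \<rho> \<le> z"
      using orbit_point_between by blast
    \<comment> \<open>A jump point between \<open>y\<close> and \<open>z\<close>: no value of
      \<open>phi\<close> lies strictly between \<open>phi \<theta> - g\<close> and
      \<open>phi \<theta>\<close>, although both lie between \<open>a\<close> and
      \<open>b\<close>.\<close>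
    define \<theta> where "\<theta> = of_int N + real (Suc k) * \<rho>"
    obtain g where g: "g > 0" "\<forall>y z (N::int). y < of_int N + real (Suc k) * \<rho> \<and> of_int N + real (Suc k) * \<rho> \<le> z \<longrightarrow> phi y + g \<le> phi z"
      using phi_jump by blast
    have jump: "phi w + g \<le> phi \<theta>" if "w < \<theta>" for w using g(2) that unfolding \<theta>_def by blast
    have "phi \<theta> \<le> phi z" using kN(2) phi_less_iff[of z \<theta>] by (simp add: \<theta>_def not_less[symmetric])
    then have "phi \<theta> \<le> b" "a \<le> phi \<theta> - g" using jump[of y] kN(1) yz unfolding \<theta>_def by linarith+
    then obtain w where w: "phi \<theta> - g < phi w" "phi w < phi \<theta>" using hit[of "phi \<theta> - g" "phi \<theta>"] g(1) by auto
    then have "w < \<theta>" using phi_less_iff by simp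
    then show False using jump[of w] w(1) by linarith
  qed
qed

end

section \<open>Rational rotation number: the cycle\<close>

locale phi_map_cycle = phi_map_rotation lam \<mu> \<delta> \<rho> + phi_map_rational lam \<mu> \<delta> \<rho> p q
  for lam \<mu> \<delta> \<rho> :: real and p q :: nat +
  assumes phi_before_0_neg: "phi (- 1 / real q) < 0"
begin

text \<open>As \<open>p\<close> is invertible modulo \<open>q\<close>, every grid point
  \<open>j / q\<close> has the form \<open>N + k * \<rho>\<close> with k at least 1, so
  \<open>phi\<close> jumps at the left end of every cell.\<close>

lemma phi_strict_mono_grid:
  assumes "\<lfloor>real q * y\<rfloor> < \<lfloor>real q * z\<rfloor>" shows "phi y < phi z"
proof -
  define j where "j = \<lfloor>real q * z\<rfloor>"
  obtain k i where k: "1 \<le> k" "0 + int (k * p) - i * int q = j"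
    using coprime_residue_hit[OF coprime_pq q_pos] by blast
  have "real_of_int (int (k * p) - i * int q) = of_int j" using k(2) by simp
  then have \<theta>: "real q * (of_int (- i) + real k * \<rho>) = of_int j"
    using q_times_shift[of "of_int (- i)" k] by (simp add: algebra_simps)
  have "real q * y < real q * (of_int (- i) + real k * \<rho>)"
    using assms unfolding \<theta> by (simp add: j_def floor_less_iff[symmetric] del: floor_less_iff)
  then have "y < of_int (- i) + real k * \<rho>" using q_pos by simp
  moreover have "real q * (of_int (- i) + real k * \<rho>) \<le> real q * z" unfolding \<theta> j_def by (rule of_int_floor_le)
  then have "of_int (- i) + real k * \<rho> \<le> z" using q_pos by simp
  moreover have "Suc (k - 1) = k" using k(1) by simp
  moreover obtain g where "g > 0" "\<forall>y z (N::int). y < of_int N + real (Suc (k - 1)) * \<rho> \<and> of_int N + real (Suc (k - 1)) * \<rho> \<le> z \<longrightarrow> phi y + g \<le> phi z"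
    using phi_jump by blast
  ultimately have "0 < g" "phi y + g \<le> phi z" by metis+
  then show ?thesis by linarith
qed

lemma phi_eq_iff: "phi y = phi z \<longleftrightarrow> \<lfloor>real q * y\<rfloor> = \<lfloor>real q * z\<rfloor>"
proof
  assume eq: "phi y = phi z"
  show "\<lfloor>real q * y\<rfloor> = \<lfloor>real q * z\<rfloor>"
    using phi_strict_mono_grid[of y z] phi_strict_mono_grid[of z y] eq by linarith
qed (rule phi_cong)

sublocale phi_map_conjugacy lam \<mu> \<delta> \<rho>
proof unfold_locales
  fix y :: real
  \<comment> \<open>The last cell before the next integer, where \<open>phi\<close> is largest on
    the unit interval of \<open>y\<close>.\<close>
  let ?z = "of_int (\<lfloor>y\<rfloor> + 1) - 1 / real q"
  have "\<lfloor>real q * y\<rfloor> \<le> \<lfloor>real q * ?z\<rfloor>"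
  proof -
    have "real q * (of_int \<lfloor>real q * y\<rfloor> / real q) \<le> real q * ?z" using grid_le[of y] by (rule mult_left_mono) simp
    then have "of_int \<lfloor>real q * y\<rfloor> \<le> real q * ?z" using q_pos by simp
    then show ?thesis by (simp only: le_floor_iff)
  qed
  then have "phi y \<le> phi ?z" using phi_strict_mono_grid[of y ?z] phi_cong[of y ?z] by linarith
  also have "\<dots> = phi (- 1 / real q) + of_int (\<lfloor>y\<rfloor> + 1)"
    using phi_add_int[of "- 1 / real q" "\<lfloor>y\<rfloor> + 1"] by (simp add: algebra_simps)
  finally show "phi y < of_int \<lfloor>y\<rfloor> + 1" using phi_before_0_neg by simp
qed

lemma C_grid: "C = {phi (real m / real q) | m. m \<le> q - 1}"
proof -
  have "{..<q} = {m. m \<le> q - 1}" using q_pos by auto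
  then show ?thesis unfolding C_eq phi_image_grid by blast
qed

lemma cycle_C: "is_cycle f q C"
  unfolding is_cycle_def
proof (intro conjI exI)
  have zero: "(0::real) \<in> I01" by simp
  show "0 < q" by (rule q_pos)
  have "real q * \<rho> = of_int (int p)" using q_pos by (simp add: rot_eq)
  then show "(f ^^ q) (phi 0) = phi 0" using f_iter_phi[OF zero, of q] by (simp add: frac_def)
  show inj: "inj_on (\<lambda>k. (f ^^ k) (phi 0)) {..<q}"
  proof (rule inj_onI)
    fix k l assume kl: "k \<in> {..<q}" "l \<in> {..<q}" "(f ^^ k) (phi 0) = (f ^^ l) (phi 0)"
    have fl: "\<lfloor>real q * frac (0 + real j * \<rho>)\<rfloor> = int (j * p) - int q * \<lfloor>real j * \<rho>\<rfloor>" for j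
    proof -
      have "real q * frac (0 + real j * \<rho>) = of_int (int (j * p) - int q * \<lfloor>real j * \<rho>\<rfloor>)"
        using q_times_shift[of 0 j] by (simp add: frac_def right_diff_distrib)
      then show ?thesis by (simp only: floor_of_int)
    qed
    have "int (k * p) - int q * \<lfloor>real k * \<rho>\<rfloor> = int (l * p) - int q * \<lfloor>real l * \<rho>\<rfloor>"
      using kl(3) unfolding f_iter_phi[OF zero] phi_eq_iff fl .
    then have "(int k - int l) * int p = int q * (\<lfloor>real k * \<rho>\<rfloor> - \<lfloor>real l * \<rho>\<rfloor>)" by (simp add: algebra_simps)
    then have "int q dvd (int k - int l) * int p" by simp
    then have dvd: "int q dvd int k - int l" using coprime_pq by (simp add: coprime_commute coprime_dvd_mult_left_iff)
    show "k = l"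
    proof (rule ccontr)
      assume "k \<noteq> l"
      then have "\<bar>int q\<bar> \<le> \<bar>int k - int l\<bar>" using dvd by (intro dvd_imp_le_int) simp_all
      then show False using kl(1,2) by (simp add: abs_if split: if_splits)
    qed
  qed
  show "C = (\<lambda>k. (f ^^ k) (phi 0)) ` {..<q}"
  \<comment> \<open>By counting: the first \<open>q\<close> iterates of \<open>phi 0\<close> are
    distinct members of \<open>C\<close>, which has at most \<open>q\<close> elements.\<close>
  proof (rule card_subset_eq[symmetric])
    show "finite C" by (simp add: C_eq phi_image_grid)
    show "(\<lambda>k. (f ^^ k) (phi 0)) ` {..<q} \<subseteq> C" unfolding C_eq f_iter_phi[OF zero] by (auto simp: frac_lt_1)
    then have "card ((\<lambda>k. (f ^^ k) (phi 0)) ` {..<q}) \<le> card C" using \<open>finite C\<close> by (intro card_mono)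
    moreover have "card C \<le> q" unfolding C_eq phi_image_grid using card_image_le[of "{..<q}"] by simp
    ultimately show "card ((\<lambda>k. (f ^^ k) (phi 0)) ` {..<q}) = card C" using card_image[OF inj] by simp
  qed
qed

lemma omega_limit_C: "x \<in> I01 \<Longrightarrow> omega_limit f x = C"
  by (simp add: omega_limit_eq C_eq phi_image_grid finite_imp_closed)

end

section \<open>Boundary value of \<open>\<delta>\<close>: the empty limit set\<close>

context phi_map_degenerate
begin

sublocale phi_map_rotation lam \<mu> \<delta> \<rho>
  by unfold_locales (simp add: rho_eq)

text \<open>A backward orbit of \<open>F\<close> would follow \<open>phi (y - k * \<rho>)\<close> and hence reach an integer \<open>N = phi (N - 1 / q)\<close>,
  whose integer part differs from that of \<open>N - 1 / q\<close>.\<close>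

lemma C_empty: "C = {}"
proof (rule ccontr)
  assume "C \<noteq> {}"
  then obtain x where "x \<in> C" by blast
  then obtain X y K where X: "\<forall>k\<ge>K. \<lfloor>X k\<rfloor> = \<lfloor>y - real k * \<rho>\<rfloor> \<and> X k = phi (y - real k * \<rho>)"
    using C_backward_phi by blast
  obtain k i where k: "K \<le> k" "- 1 + int (k * p) - i * int q = \<lfloor>real q * y\<rfloor>"
    using coprime_residue_hit[OF coprime_pq q_pos] by blast
  let ?z = "y - real k * \<rho>"
  have "real q * ?z = real q * y + of_int (- int (k * p))" using q_times_shift[of 0 k] by (simp add: right_diff_distrib)
  then have "\<lfloor>real q * ?z\<rfloor> = \<lfloor>real q * y\<rfloor> + - int (k * p)" by (simp only: floor_add_int)
  then have fl: "\<lfloor>real q * ?z\<rfloor> = - 1 - i * int q" using k(2) by simp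
  have "real q * (of_int (- i) - 1 / real q) = of_int (- 1 - i * int q)" using q_pos by (simp add: field_simps)
  then have fl': "\<lfloor>real q * (of_int (- i) - 1 / real q)\<rfloor> = - 1 - i * int q" by (simp only: floor_of_int)
  then have "phi ?z = phi (of_int (- i) - 1 / real q)" by (intro phi_cong) (simp only: fl)
  then have "phi ?z = of_int (- i)" by (simp only: phi_int_before)
  moreover have "\<lfloor>?z\<rfloor> = \<lfloor>of_int (- i) - 1 / real q\<rfloor>"
    using floor_div[of ?z] floor_div[of "of_int (- i) - 1 / real q"] fl fl' by (simp only:)
  moreover have "\<lfloor>phi ?z\<rfloor> = \<lfloor>?z\<rfloor>" using X k(1) by metis
  ultimately have "\<lfloor>of_int (- i) - 1 / real q\<rfloor> = - i" by (simp only: floor_of_int)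
  then have "real_of_int (- i) \<le> of_int (- i) - 1 / real q" by (metis of_int_floor_le)
  then show False using q_pos by simp
qed

lemma inj_on_phi_grid: "inj_on (\<lambda>m. phi (real m / real q)) {..<q}"
proof (rule linorder_inj_onI)
  fix m n :: nat assume "m < n"
  then have "real m + 1 \<le> real n" by simp
  then have "real m / real q \<le> real n / real q - 1 / real q" using q_pos by (simp add: field_simps)
  then have "phi (real m / real q) \<le> phi (real n / real q - 1 / real q)" by (rule phi_mono)
  then show "phi (real m / real q) \<noteq> phi (real n / real q)" using D_pos[of "real n / real q"] by (simp add: D_def)
qed auto

lemma card_phi_image: "finite (phi ` I01)" "card (phi ` I01) = q"
  unfolding phi_image_grid using card_image[OF inj_on_phi_grid] by simp_all

lemma one_in_phi_image: "1 \<in> phi ` I01"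
proof (rule image_eqI)
  show "1 = phi (1 - 1 / real q)" using phi_int_before[of 1] by simp
  show "1 - 1 / real q \<in> I01" using q_pos by (simp add: field_simps)
qed

lemma omega_limit_phi_image: "x \<in> I01 \<Longrightarrow> omega_limit f x = phi ` I01"
  by (simp add: omega_limit_eq phi_image_grid finite_imp_closed)

end

text \<open>\<open>jump_pos\<close> is \<open>\<delta> * (\<mu> - 1) < \<mu> - lam * \<mu>\<close>
  rearranged; in both cases of \<open>d_bound\<close> this and \<open>\<delta> < 1\<close> follow,
  so the case distinction disappears from the locale.\<close>

lemma contracted_mapI:
  assumes "0 < lam" "lam < 1" "0 < \<mu>" "1 - lam < \<delta>" "\<delta> < d_bound lam \<mu>"
  shows "contracted_map lam \<mu> \<delta>"
proof -
  have *: "\<delta> < 1 \<and> \<delta> * (\<mu> - 1) < \<mu> - lam * \<mu>"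
  proof (cases "lam * \<mu> < 1")
    case True
    then have d: "\<delta> < 1" using assms(5) by (simp add: d_bound_def)
    moreover have "\<delta> * (\<mu> - 1) < \<mu> - lam * \<mu>"
    proof (cases "1 < \<mu>")
      case True
      then have "\<delta> * (\<mu> - 1) < 1 * (\<mu> - 1)" using d by (intro mult_strict_right_mono) auto
      then show ?thesis using \<open>lam * \<mu> < 1\<close> by simp
    next
      case False
      then have "\<delta> * (\<mu> - 1) \<le> 0" using assms by (intro mult_nonneg_nonpos) auto
      moreover have "lam * \<mu> < 1 * \<mu>" using assms by (intro mult_strict_right_mono) auto
      ultimately show ?thesis by simp
    qed
    ultimately show ?thesis by blast
  next
    case False
    have "lam * \<mu> < 1 * \<mu>" using assms by (intro mult_strict_right_mono) auto
    then have mu: "1 < \<mu>" using False by simp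
    have d: "\<delta> < (\<mu> - lam * \<mu>) / (\<mu> - 1)" using assms(5) False by (simp add: d_bound_def)
    also have "\<dots> \<le> 1" using mu False by (simp add: field_simps)
    finally have "\<delta> < 1" .
    moreover have "\<delta> * (\<mu> - 1) < \<mu> - lam * \<mu>" using d mu by (simp add: pos_less_divide_eq)
    ultimately show ?thesis by blast
  qed
  then have "\<mu> * (lam + \<delta> - 1) < \<delta>" by (simp add: algebra_simps)
  then show ?thesis using assms * by unfold_locales auto
qed

lemma r_bound_contraction:
  assumes "0 < lam" "lam < 1" "0 < \<mu>" "0 < \<rho>" "\<rho> < r_bound lam \<mu>"
  shows "\<rho> < 1" "lam * \<mu> powr \<rho> < 1"
proof -
  have "\<rho> < 1 \<and> lam * \<mu> powr \<rho> < 1"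
  proof (cases "lam * \<mu> < 1")
    case True
    then have r: "\<rho> < 1" using assms by (simp add: r_bound_def)
    have "lam * \<mu> powr \<rho> < 1"
    proof (cases "1 < \<mu>")
      case True
      then have "\<mu> powr \<rho> \<le> \<mu> powr 1" using r by (intro powr_mono) auto
      then have "lam * \<mu> powr \<rho> \<le> lam * \<mu>" using assms by simp
      then show ?thesis using \<open>lam * \<mu> < 1\<close> by simp
    next
      case False
      then have "\<mu> powr \<rho> \<le> 1" using assms by (intro powr_le1) auto
      then have "lam * \<mu> powr \<rho> \<le> lam * 1" using assms by (intro mult_left_mono) auto
      then show ?thesis using assms(2) by linarith
    qed
    then show ?thesis using r by blast
  next
    case False
    have "lam * \<mu> < 1 * \<mu>" using assms by (intro mult_strict_right_mono) auto
    then have mu: "1 < \<mu>" "0 < ln \<mu>" using False by (simp_all add: ln_gt_zero)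
    have r: "\<rho> < - ln lam / ln \<mu>" using assms False by (simp add: r_bound_def)
    have "0 \<le> ln (lam * \<mu>)" using False by (intro ln_ge_zero) simp
    then have "- ln lam \<le> ln \<mu>" using assms by (simp add: ln_mult)
    then have "- ln lam / ln \<mu> \<le> 1" using mu by (simp add: field_simps)
    moreover have "\<rho> * ln \<mu> < - ln lam" using r mu(2) by (simp only: pos_less_divide_eq)
    then have "ln lam + \<rho> * ln \<mu> < 0" by simp
    then have "exp (ln lam + \<rho> * ln \<mu>) < 1" by simp
    then have "lam * \<mu> powr \<rho> < 1" using assms mu by (simp add: exp_add powr_def)
    ultimately show ?thesis using r by linarith
  qed
  then show "\<rho> < 1" "lam * \<mu> powr \<rho> < 1" by blast+
qed

theorem theorem3:
  fixes lam \<mu> \<delta> \<rho> :: real and f \<phi> :: "real \<Rightarrow> real" and C :: "real set"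
  assumes "0 < lam" "lam < 1" "\<mu> > 0"
    and "1 - lam < \<delta>" "\<delta> < d_bound lam \<mu>"
    and "f = circ_map lam \<mu> \<delta>"
    and "\<rho> = rotation_number lam \<mu> \<delta>"
    and "\<phi> = phi_fun lam \<mu> \<delta> \<rho>"
    and "C = (\<Inter>k\<in>{1..}. (f ^^ k) ` I01)"
  shows
    "(\<rho> \<notin> \<rat> \<longrightarrow>
        C = \<phi> ` I01 \<and> f ` C = C \<and> bij_betw \<phi> I01 C
        \<and> (\<forall>y\<in>I01. f (\<phi> y) = \<phi> (rot \<rho> y))
        \<and> cantor_set (closure (\<phi> ` I01))
        \<and> (\<forall>x\<in>I01. omega_limit f x = closure C))
     \<and>
     (\<forall>p q :: nat. q > 0 \<and> coprime p q \<and> \<rho> = real p / real q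
        \<and> delta_left lam \<mu> (real p / real q) \<le> \<delta>
        \<and> \<delta> < delta_fun lam \<mu> (real p / real q) \<longrightarrow>
        C = \<phi> ` I01 \<and> C = {\<phi> (real m / real q) | m. m \<le> q - 1}
        \<and> is_cycle f q C
        \<and> (\<forall>y\<in>{real m / real q | m. m \<le> q - 1}. f (\<phi> y) = \<phi> (rot (real p / real q) y))
        \<and> (\<forall>x\<in>I01. omega_limit f x = C))
     \<and>
     (\<forall>p q :: nat. p > 0 \<and> q > 0 \<and> coprime p q \<and> real p / real q < r_bound lam \<mu>
        \<and> \<delta> = delta_fun lam \<mu> (real p / real q) \<longrightarrow>
        C = {} \<and> finite (\<phi> ` I01) \<and> card (\<phi> ` I01) = q \<and> 1 \<in> \<phi> ` I01
        \<and> (\<forall>x\<in>I01. omega_limit f x = \<phi> ` I01))"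
proof (intro conjI impI allI)
  interpret contracted_map lam \<mu> \<delta> using assms(1-5) by (rule contracted_mapI)
  have \<rho>: "\<rho> = rho" using assms(7) by (simp add: rho_def)
  interpret phi_map_rotation lam \<mu> \<delta> \<rho>
    using rho_pos rho_less_1 lam_mu_powr_rho by unfold_locales (simp_all add: \<rho>)
  have \<phi>: "\<phi> = phi" using assms(8) by (simp add: phi_def)
  \<comment> \<open>This constant does not depend on \<open>\<rho>\<close>, so it also serves the
    interpretation at p/q below.\<close>
  have C: "(\<Inter>k\<in>{1..}. (circ_map lam \<mu> \<delta> ^^ k) ` I01) = phi_map_rotation.C lam \<mu> \<delta>" by (simp add: C_def)
  note defs = \<phi> assms(6,9) C
  { assume "\<rho> \<notin> \<rat>"
    then interpret phi_map_irrational lam \<mu> \<delta> \<rho> by unfold_locales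
    have "cantor_set (closure (phi ` I01))"
      using perfect_no_interval_closure by (rule perfect_no_interval.cantor_set)
    then show "C = \<phi> ` I01" "f ` C = C" "bij_betw \<phi> I01 C" "\<forall>y\<in>I01. f (\<phi> y) = \<phi> (rot \<rho> y)"
      "cantor_set (closure (\<phi> ` I01))" "\<forall>x\<in>I01. omega_limit f x = closure C"
      unfolding defs using C_eq f_image_C bij_betw_phi f_phi omega_limit_eq by simp_all }
  { fix p q :: nat
    assume pq: "q > 0 \<and> coprime p q \<and> \<rho> = real p / real q
        \<and> delta_left lam \<mu> (real p / real q) \<le> \<delta> \<and> \<delta> < delta_fun lam \<mu> (real p / real q)"
    interpret phi_map_rational lam \<mu> \<delta> \<rho> p q using pq by unfold_locales auto
    have "(1 - lam) * phi (- 1 / real q) < 0"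
      unfolding phi_before_0 using denominator_pos pq by (intro mult_pos_neg) simp_all
    then have "phi (- 1 / real q) < 0" using lam_less_1 by (simp add: mult_less_0_iff)
    then interpret phi_map_cycle lam \<mu> \<delta> \<rho> p q by unfold_locales
    have "f (\<phi> y) = \<phi> (rot (real p / real q) y)" if "y \<in> {real m / real q | m. m \<le> q - 1}" for y
    proof -
      have "y \<in> I01" using that q_pos by auto
      then show ?thesis unfolding defs using f_phi rot_eq by simp
    qed
    then show "C = \<phi> ` I01" "C = {\<phi> (real m / real q) | m. m \<le> q - 1}" "is_cycle f q C"
      "\<forall>y\<in>{real m / real q | m. m \<le> q - 1}. f (\<phi> y) = \<phi> (rot (real p / real q) y)"
      "\<forall>x\<in>I01. omega_limit f x = C"
      unfolding defs using C_eq C_grid cycle_C omega_limit_C by blast+ }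
  { fix p q :: nat
    assume pq: "p > 0 \<and> q > 0 \<and> coprime p q \<and> real p / real q < r_bound lam \<mu>
        \<and> \<delta> = delta_fun lam \<mu> (real p / real q)"
    then have pos: "0 < real p / real q" by simp
    \<comment> \<open>A separate instance, since p/q is not yet known to be the rotation number;
      only \<open>R.rho_eq\<close> shows it and thereby identifies \<open>\<phi>\<close> with
      \<open>R.phi\<close>.\<close>
    interpret R: phi_map_rational lam \<mu> \<delta> "real p / real q" p q
      using pq pos r_bound_contraction[OF assms(1-3) pos] by unfold_locales auto
    have "(1 - lam) * R.phi (- 1 / real q) = 0" unfolding R.phi_before_0 using pq by simp
    then have "R.phi (- 1 / real q) = 0" using lam_less_1 by simp
    then interpret R: phi_map_degenerate lam \<mu> \<delta> "real p / real q" p q by unfold_locales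
    have \<phi>': "\<phi> = R.phi" unfolding \<phi> phi_def R.phi_def using R.rho_eq \<rho> by simp
    show "C = {}" "finite (\<phi> ` I01)" "card (\<phi> ` I01) = q" "1 \<in> \<phi> ` I01"
      "\<forall>x\<in>I01. omega_limit f x = \<phi> ` I01"
      unfolding \<phi>' assms(6,9) C
      using R.C_empty R.card_phi_image R.one_in_phi_image R.omega_limit_phi_image by simp_all }
qed

end
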